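(* Let $a,b,c,d,f,g$ be complex numbers with $\max\{|a|,|b|,|c|,|d|,|g|\}<1$. Then $$\int_{0}^{\pi}\frac{(e^{2i\theta},e^{-2i\theta},fge^{i\theta};q)_\infty}{(ae^{i\theta},ae^{-i\theta},be^{i\theta},be^{-i\theta},ce^{i\theta},ce^{-i\theta},de^{i\theta},de^{-i\theta},ge^{i\theta};q)_\infty}\;{}_{3}\phi_2\left[\begin{array}{c}f,\ ae^{i\theta},\ be^{i\theta}\\ fge^{i\theta},\ ab\end{array};q,ge^{-i\theta}\right]d\theta$$ $$=\frac{2\pi(cfg,abcd;q)_\infty}{(q,ab,ac,ad,bc,bd,cd,cg;q)_\infty}\;{}_{3}\phi_2\left[\begin{array}{c}f,\ ac,\ bc\\ cfg,\ abcd\end{array};q,dg\right].$$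
   Context: Let $|q|<1$. The $q$-shifted factorials are $(x;q)_\infty=\prod_{k=0}^{\infty}(1-xq^k)$ and $(x;q)_n=(x;q)_\infty/(xq^n;q)_\infty$, with $(x_1,\ldots,x_m;q)_n=(x_1;q)_n\cdots(x_m;q)_n$ for $n$ an integer or $\infty$. The basic hypergeometric series ${}_3\phi_2$ is ${}_{3}\phi_2\left[\begin{array}{c}a_1,a_2,a_3\\ b_1,b_2\end{array};q,z\right]=\sum_{k=0}^\infty\frac{(a_1,a_2,a_3;q)_k}{(q,b_1,b_2;q)_k}z^k$. As is standard for basic hypergeometric series, parameters are assumed to be such that no denominator vanishes. *)

theory Defs
  imports "HOL-Analysis.Analysis"
begin

definition qpoch_inf :: "complex \<Rightarrow> complex \<Rightarrow> complex" where
  "qpoch_inf x q = (\<Prod>k. 1 - x * q ^ k)"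

text \<open>
  For \<open>n \<ge> 0\<close> the quotient \<open>(x;q)\<^sub>\<infinity> / (xq\<^sup>n;q)\<^sub>\<infinity>\<close> is the finite product below
  (\<open>qpoch_eq_quotient\<close>). The finite product is taken as the definition because the
  quotient reads \<open>0/0\<close> when \<open>x = q\<^sup>-\<^sup>m\<close> with \<open>m \<ge> n\<close>, as in terminating series.
\<close>

definition qpoch :: "complex \<Rightarrow> complex \<Rightarrow> nat \<Rightarrow> complex" where
  "qpoch x q n = (\<Prod>k<n. 1 - x * q ^ k)"

definition qpochs_inf :: "complex list \<Rightarrow> complex \<Rightarrow> complex" where
  "qpochs_inf xs q = (\<Prod>x\<leftarrow>xs. qpoch_inf x q)"

definition qpochs :: "complex list \<Rightarrow> complex \<Rightarrow> nat \<Rightarrow> complex" where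
  "qpochs xs q n = (\<Prod>x\<leftarrow>xs. qpoch x q n)"

definition phi32 ::
  "complex \<Rightarrow> complex \<Rightarrow> complex \<Rightarrow> complex \<Rightarrow> complex \<Rightarrow> complex \<Rightarrow> complex \<Rightarrow> complex" where
  "phi32 a1 a2 a3 b1 b2 q z =
     (\<Sum>k. qpochs [a1, a2, a3] q k / qpochs [q, b1, b2] q k * z ^ k)"

lemma convergent_prod_qpoch:
  fixes x q :: complex
  assumes "norm q < 1"
  shows "convergent_prod (\<lambda>k. 1 - x * q ^ k)"
proof -
  have "summable (\<lambda>k. norm x * norm q ^ k)"
    using assms by (intro summable_mult summable_geometric) simp
  then have "abs_convergent_prod (\<lambda>k. 1 - x * q ^ k)"
    by (simp add: abs_convergent_prod_conv_summable norm_mult norm_power)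
  then show ?thesis
    by (rule abs_convergent_prod_imp_convergent_prod)
qed

lemma qpoch_eq_quotient:
  assumes "norm q < 1" and "qpoch_inf (x * q ^ n) q \<noteq> 0"
  shows "qpoch x q n = qpoch_inf x q / qpoch_inf (x * q ^ n) q"
proof -
  have "(\<lambda>k. 1 - x * q ^ k) has_prod (qpoch x q n * qpoch_inf (x * q ^ n) q)"
    using has_prod_ignore_initial_segment'[OF convergent_prod_qpoch[OF assms(1)], of x n]
    by (simp add: qpoch_def qpoch_inf_def power_add mult_ac)
  then have "qpoch_inf x q = qpoch x q n * qpoch_inf (x * q ^ n) q"
    unfolding qpoch_inf_def by (metis has_prod_unique)
  then show ?thesis using assms(2) by simp
qed

end

theory Submission
  imports Defs
begin

text \<open>
  The theorem is the image of the Askey-Wilson integral under a \<open>q\<close>-difference operator. Write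
  \<open>(x)\<close> for \<open>(x;q)\<^sub>\<infinity>\<close>, \<open>z = e\<^sup>i\<^sup>\<theta>\<close> and \<open>h(a;s,t,u) = (atu)/((as)(at))\<close>. After multiplication by
  \<open>(ab)\<close> the Askey-Wilson integral says that
  \<open>\<integral> K(\<theta>) h(a; z, 1/z, bz) d\<theta> = C h(a; c, d, bc)\<close> for all \<open>|a| < 1\<close>, where neither \<open>K\<close> nor \<open>C\<close>
  involves \<open>a\<close>. Let \<open>D h(a) = (h(a) - h(aq))/a\<close>; it acts on \<open>a\<close> alone and so may be applied under the
  integral, and with it the operator
  \<open>\<Sum>\<^sub>n (f;q)\<^sub>n/(q;q)\<^sub>n (gD)\<^sup>n\<close>.

  Two facts make this explicit. First, \<open>D\<^sup>n h = h R\<^sub>n\<close> with a finite sum \<open>R\<^sub>n\<close> in the same parameters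
  (\<open>qkernel_qdifference\<close>). Second, by the \<open>q\<close>-binomial theorem
  \<open>\<Sum>\<^sub>n (f;q)\<^sub>n/(q;q)\<^sub>n g\<^sup>n R\<^sub>n = (fgs)/(gs) \<^sub>3\<phi>\<^sub>2[f, as, u; fgs, atu; q, gt]\<close>
  (\<open>phi32_reg_sums\<close>, \<open>phi32_reg_eq_phi32\<close>). With \<open>(s,t,u) = (z, 1/z, bz)\<close> this is the series in the
  integrand, with \<open>(s,t,u) = (c, d, bc)\<close> it is the series on the right. The transfer of
  the identity from \<open>h\<close> to \<open>h\<close> times the series is \<open>has_integral_phi32_reg\<close>.

  The Askey-Wilson integral comes from the same mechanism. For \<open>f = u = 0\<close> the series can be summed, and
  the operator adds one more parameter to the integral (\<open>has_integral_add_parameter\<close>). Three such steps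
  lead from one parameter to four. With a single parameter \<open>a\<close> the
  coefficient of \<open>a\<^sup>n/(q;q)\<^sub>n\<close> is the integral of the \<open>n\<close>-th continuous \<open>q\<close>-Hermite polynomial against the weight
  \<open>(z\<^sup>2)(z\<^sup>-\<^sup>2)\<close>. Splitting this weight into a theta function and its mirror image turns the
  integral into a sum of theta coefficients, and that sum is the finite
  Jacobi triple product at the point \<open>1\<close>, which vanishes for \<open>n > 0\<close> (\<open>has_integral_qhermite\<close>).
\<close>

section \<open>Shifted factorials and Gaussian binomial coefficients\<close>

lemma qpoch_0 [simp]: "qpoch x q 0 = 1"
  by (simp add: qpoch_def)

lemma qpoch_Suc: "qpoch x q (Suc n) = qpoch x q n * (1 - x * q ^ n)"
  by (simp add: qpoch_def)

lemma qpoch_add: "qpoch x q (m + n) = qpoch x q m * qpoch (x * q ^ m) q n"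
  by (induction n) (simp_all add: qpoch_Suc power_add mult_ac)

lemma qpoch_Suc_shift: "qpoch x q (Suc n) = (1 - x) * qpoch (x * q) q n"
  using qpoch_add[of x q 1 n] by (simp add: qpoch_Suc)

lemma qpoch_zero_left [simp]: "qpoch 0 q n = 1"
  by (simp add: qpoch_def)

lemma qpoch_inf_zero [simp]: "qpoch_inf 0 q = 1"
  by (simp add: qpoch_inf_def)

definition qbinom :: "complex \<Rightarrow> nat \<Rightarrow> nat \<Rightarrow> complex" where
  "qbinom q n k = (if k \<le> n then qpoch q q n / (qpoch q q k * qpoch q q (n - k)) else 0)"

lemma continuous_on_qpoch [continuous_intros]:
  "continuous_on A f \<Longrightarrow> continuous_on A (\<lambda>x. qpoch (f x) q n)"
  unfolding qpoch_def by (intro continuous_intros)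

context
  fixes q :: complex
  assumes q: "norm q < 1"
begin

lemma qpoch_tendsto: "(\<lambda>n. qpoch x q n) \<longlonglongrightarrow> qpoch_inf x q"
proof -
  have "(\<lambda>n. \<Prod>k\<le>n. 1 - x * q ^ k) \<longlonglongrightarrow> qpoch_inf x q"
    unfolding qpoch_inf_def by (rule convergent_prod_LIMSEQ[OF convergent_prod_qpoch[OF q]])
  then have "(\<lambda>n. qpoch x q (Suc n)) \<longlonglongrightarrow> qpoch_inf x q"
    by (simp add: qpoch_def lessThan_Suc_atMost)
  then show ?thesis by (rule LIMSEQ_imp_Suc)
qed

lemma qpoch_inf_split: "qpoch_inf x q = qpoch x q n * qpoch_inf (x * q ^ n) q"
proof (rule LIMSEQ_unique)
  show "(\<lambda>m. qpoch x q (n + m)) \<longlonglongrightarrow> qpoch_inf x q"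
    using LIMSEQ_ignore_initial_segment[OF qpoch_tendsto, of x n] by (simp add: add.commute)
  show "(\<lambda>m. qpoch x q (n + m)) \<longlonglongrightarrow> qpoch x q n * qpoch_inf (x * q ^ n) q"
    unfolding qpoch_add by (intro tendsto_intros qpoch_tendsto)
qed

lemma qpoch_inf_step: "qpoch_inf x q = (1 - x) * qpoch_inf (x * q) q"
  using qpoch_inf_split[of x 1] by (simp add: qpoch_Suc)

lemma norm_mult_qpow_less: "norm x < 1 \<Longrightarrow> norm (x * q ^ k) < 1"
  using q by (metis (no_types) less_eq_real_def mult_left_le norm_ge_zero norm_mult norm_power
      order_le_less_trans power_le_one)

lemma qfactor_nz: "norm x < 1 \<Longrightarrow> 1 - x * q ^ k \<noteq> 0"
  using norm_mult_qpow_less[of x k] by auto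

lemma qpoch_nz: "norm x < 1 \<Longrightarrow> qpoch x q n \<noteq> 0"
  by (simp only: qpoch_def prod_zero_iff finite_lessThan) (use qfactor_nz in auto)

lemma qpoch_inf_nz: "norm x < 1 \<Longrightarrow> qpoch_inf x q \<noteq> 0"
  unfolding qpoch_inf_def by (rule prodinf_nonzero[OF convergent_prod_qpoch[OF q]]) (rule qfactor_nz)

text \<open>
  The bound depends neither on \<open>n\<close> nor on the argument within a disc; dominating
  functions and series for the exchanges of limits below are built from it.
\<close>
lemma norm_qpoch_le: "norm x \<le> R \<Longrightarrow> norm (qpoch x q n) \<le> exp (R / (1 - norm q))"
proof -
  assume R: "norm x \<le> R"
  have R0: "0 \<le> R" using R norm_ge_zero order_trans by blast
  have "norm (qpoch x q n) = (\<Prod>k<n. norm (1 - x * q ^ k))"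
    by (simp add: qpoch_def prod_norm)
  also have "\<dots> \<le> (\<Prod>k<n. exp (R * norm q ^ k))"
  proof (intro prod_mono conjI norm_ge_zero)
    fix k
    have "norm (1 - x * q ^ k) \<le> 1 + norm x * norm q ^ k"
      by (rule order_trans[OF norm_triangle_ineq4]) (simp add: norm_mult norm_power)
    also have "\<dots> \<le> 1 + R * norm q ^ k" using R by (simp add: mult_right_mono)
    also have "\<dots> \<le> exp (R * norm q ^ k)" by (rule exp_ge_add_one_self)
    finally show "norm (1 - x * q ^ k) \<le> exp (R * norm q ^ k)" .
  qed
  also have "\<dots> = exp (R * (\<Sum>k<n. norm q ^ k))"
    by (simp add: exp_sum sum_distrib_left)
  also have "\<dots> \<le> exp (R / (1 - norm q))"
  proof -
    have "(\<Sum>k<n. norm q ^ k) \<le> (\<Sum>k. norm q ^ k)"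
      using q by (intro sum_le_suminf summable_geometric) auto
    also have "\<dots> = 1 / (1 - norm q)" using q by (simp add: suminf_geometric)
    finally show ?thesis using R0 mult_left_mono by fastforce
  qed
  finally show ?thesis .
qed

text \<open>
  The factorials tend to \<open>(x;q)\<^sub>\<infinity>\<close>, which is nonzero for \<open>|x| < 1\<close>, so they stay away from zero.
\<close>
lemma inverse_qpoch_bounded:
  assumes "norm x < 1"
  obtains B where "B \<ge> 0" "\<And>n. norm (inverse (qpoch x q n)) \<le> B"
proof -
  have "(\<lambda>n. inverse (qpoch x q n)) \<longlonglongrightarrow> inverse (qpoch_inf x q)"
    by (intro tendsto_inverse qpoch_tendsto qpoch_inf_nz assms)
  then have "Bseq (\<lambda>n. inverse (qpoch x q n))" by (rule convergent_imp_Bseq[OF convergentI])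
  then obtain B where "B > 0" "\<forall>n. norm (inverse (qpoch x q n)) \<le> B"
    by (auto simp: Bseq_def)
  then show ?thesis using that[of B] by auto
qed

lemma uniform_limit_qpoch:
  "uniform_limit (cball 0 R) (\<lambda>n x. qpoch x q n) (\<lambda>x. qpoch_inf x q) sequentially"
proof -
  have "uniformly_convergent_on (cball 0 R) (\<lambda>n x. \<Sum>k<n. norm ((1 - x * q ^ k) - 1))"
  proof (rule Weierstrass_m_test')
    show "norm (norm ((1 - x * q ^ k) - 1)) \<le> R * norm q ^ k" if "x \<in> cball 0 R" for k x
      using that by (auto simp: norm_mult norm_power intro!: mult_right_mono)
    show "summable (\<lambda>k. R * norm q ^ k)"
      using q by (intro summable_mult summable_geometric) simp
  qed
  then have "uniformly_convergent_on (cball 0 R) (\<lambda>n x. \<Prod>k<n. 1 - x * q ^ k)"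
    by (intro uniformly_convergent_on_prod') (auto intro!: continuous_intros)
  then obtain L where L: "uniform_limit (cball 0 R) (\<lambda>n x. qpoch x q n) L sequentially"
    by (auto simp: uniformly_convergent_on_def qpoch_def)
  have "L x = qpoch_inf x q" if "x \<in> cball 0 R" for x
    using tendsto_uniform_limitI[OF L that] qpoch_tendsto LIMSEQ_unique by blast
  then show ?thesis by (intro uniform_limit_cong'[THEN iffD1, OF _ _ L]) auto
qed

lemma continuous_on_qpoch_inf [continuous_intros]:
  assumes "continuous_on A f"
  shows "continuous_on A (\<lambda>x. qpoch_inf (f x) q)"
proof -
  have "continuous_on (ball 0 R) (\<lambda>x. qpoch_inf x q)" for R
  proof -
    have "continuous_on (cball 0 R) (\<lambda>x. qpoch_inf x q)"
      by (rule uniform_limit_theorem[OF _ uniform_limit_qpoch]) (auto intro!: always_eventually continuous_intros)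
    then show ?thesis by (rule continuous_on_subset) auto
  qed
  then have "isCont (\<lambda>x. qpoch_inf x q) x" for x
    by (rule continuous_on_interior[where S="ball 0 (norm x + 1)"]) auto
  then have "continuous_on UNIV (\<lambda>x. qpoch_inf x q)" by (simp add: continuous_at_imp_continuous_on)
  then show ?thesis using continuous_on_compose2[OF _ assms] by blast
qed

lemma qq_nz [simp]: "qpoch q q n \<noteq> 0"
  using q by (rule qpoch_nz)

lemma qq_factor_nz [simp]: "1 - q * q ^ k \<noteq> 0"
  using q by (rule qfactor_nz)

lemma qq_factor_neq_1 [simp]: "q * q ^ k \<noteq> 1"
  using qq_factor_nz[of k] by (metis right_minus_eq)

lemma qbinom_0 [simp]: "qbinom q n 0 = 1"
  by (simp add: qbinom_def)

lemma qbinom_self [simp]: "qbinom q n n = 1"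
  by (simp add: qbinom_def)

lemma qbinom_eq_0 [simp]: "n < k \<Longrightarrow> qbinom q n k = 0"
  by (simp add: qbinom_def)

text \<open>
  The two ratios of neighbouring coefficients, cleared of denominators. Both Pascal rules follow by comparing
  with the left-hand sides here.
\<close>
lemma qbinom_pascal_aux:
  assumes "k < n"
  shows "qbinom q (Suc n) (Suc k) * ((1 - q * q ^ k) * (1 - q * q ^ (n - Suc k)))
           = qbinom q n k * ((1 - q * q ^ n) * (1 - q * q ^ (n - Suc k)))"
    and "qbinom q n (Suc k) * ((1 - q * q ^ k)) = qbinom q n k * (1 - q * q ^ (n - Suc k))"
proof -
  have e: "n - k = Suc (n - Suc k)" using assms by simp
  show "qbinom q (Suc n) (Suc k) * ((1 - q * q ^ k) * (1 - q * q ^ (n - Suc k)))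
           = qbinom q n k * ((1 - q * q ^ n) * (1 - q * q ^ (n - Suc k)))"
    using assms by (simp add: qbinom_def qpoch_Suc)
  show "qbinom q n (Suc k) * ((1 - q * q ^ k)) = qbinom q n k * (1 - q * q ^ (n - Suc k))"
    using assms by (simp add: qbinom_def qpoch_Suc e)
qed

lemma qbinom_Suc_Suc: "qbinom q (Suc n) (Suc k) = qbinom q n k + q ^ Suc k * qbinom q n (Suc k)"
proof (cases "k < n")
  case True
  define A where "A = (1 - q * q ^ k) * (1 - q * q ^ (n - Suc k))"
  have nz: "A \<noteq> 0" by (simp add: A_def)
  have pw: "q ^ n = q ^ Suc k * q ^ (n - Suc k)"
    using True by (metis Suc_leI le_add_diff_inverse power_add)
  have "(qbinom q n k + q ^ Suc k * qbinom q n (Suc k)) * A =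
      qbinom q n k * A + q ^ Suc k * (qbinom q n (Suc k) * (1 - q * q ^ k)) * (1 - q * q ^ (n - Suc k))"
    by (simp add: A_def algebra_simps)
  also have "\<dots> = qbinom q n k * ((1 - q * q ^ n) * (1 - q * q ^ (n - Suc k)))"
    unfolding qbinom_pascal_aux(2)[OF True] A_def pw by (simp add: algebra_simps)
  also have "\<dots> = qbinom q (Suc n) (Suc k) * A"
    using qbinom_pascal_aux(1)[OF True] by (simp add: A_def)
  finally show ?thesis using nz by simp
next
  case False
  then show ?thesis by (cases "k = n") auto
qed

lemma qbinom_Suc_Suc':
  "qbinom q (Suc n) (Suc k) = q ^ (n - k) * qbinom q n k + qbinom q n (Suc k)"
proof (cases "k < n")
  case True
  define A where "A = (1 - q * q ^ k) * (1 - q * q ^ (n - Suc k))"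
  have nz: "A \<noteq> 0" by (simp add: A_def)
  have pw: "q ^ n = q ^ k * q ^ (n - k)"
    using True by (metis less_imp_le le_add_diff_inverse power_add)
  have pw': "q ^ (n - k) = q * q ^ (n - Suc k)"
    using True by (metis Suc_diff_Suc power_Suc)
  have "(q ^ (n - k) * qbinom q n k + qbinom q n (Suc k)) * A =
      q ^ (n - k) * qbinom q n k * A + (qbinom q n (Suc k) * (1 - q * q ^ k)) * (1 - q * q ^ (n - Suc k))"
    by (simp add: A_def algebra_simps)
  also have "\<dots> = qbinom q n k * ((1 - q * q ^ n) * (1 - q * q ^ (n - Suc k)))"
    unfolding qbinom_pascal_aux(2)[OF True] A_def pw pw' by (simp add: algebra_simps)
  also have "\<dots> = qbinom q (Suc n) (Suc k) * A"
    using qbinom_pascal_aux(1)[OF True] by (simp add: A_def)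
  finally show ?thesis using nz by simp
next
  case False
  then show ?thesis by (cases "k = n") auto
qed

lemma qbinom_bounded:
  obtains B where "B \<ge> 0" "\<And>n k. norm (qbinom q n k) \<le> B"
proof -
  obtain I where I: "I \<ge> 0" "\<And>n. norm (inverse (qpoch q q n)) \<le> I"
    using inverse_qpoch_bounded[OF q] by blast
  define E where "E = exp (norm q / (1 - norm q))"
  have "norm (qbinom q n k) \<le> E * (I * I)" for n k
  proof (cases "k \<le> n")
    case True
    have "norm (qbinom q n k) = norm (qpoch q q n) *
        (norm (inverse (qpoch q q k)) * norm (inverse (qpoch q q (n - k))))"
      using True by (simp add: qbinom_def norm_mult norm_divide norm_inverse divide_inverse)
    also have "\<dots> \<le> E * (I * I)"
      unfolding E_def by (intro mult_mono norm_qpoch_le I mult_nonneg_nonneg) auto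
    finally show ?thesis .
  next
    case False
    then show ?thesis using I by (simp add: E_def)
  qed
  moreover have "E * (I * I) \<ge> 0" using I by (simp add: E_def)
  ultimately show ?thesis using that by blast
qed

end

section \<open>The q-binomial theorem\<close>

context
  fixes q :: complex
  assumes q: "norm q < 1"
begin

lemma qratio_bounded:
  obtains B where "B \<ge> 0" "\<And>n. norm (qpoch \<alpha> q n / qpoch q q n) \<le> B"
proof -
  obtain I where I: "I \<ge> 0" "\<And>n. norm (inverse (qpoch q q n)) \<le> I"
    using inverse_qpoch_bounded[OF q q] by blast
  have "norm (qpoch \<alpha> q n / qpoch q q n) \<le> exp (norm \<alpha> / (1 - norm q)) * I" for n
    unfolding divide_inverse[of "qpoch \<alpha> q n"] norm_mult by (intro mult_mono norm_qpoch_le[OF q] I) auto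
  then show ?thesis using that[of "exp (norm \<alpha> / (1 - norm q)) * I"] I by auto
qed

lemma summable_qbinomial_series:
  assumes "norm x < 1"
  shows "summable (\<lambda>n. norm (qpoch \<alpha> q n / qpoch q q n * x ^ n))"
proof -
  obtain B where B: "\<And>n. norm (qpoch \<alpha> q n / qpoch q q n) \<le> B" using qratio_bounded by blast
  show ?thesis
  proof (rule summable_comparison_test'[of "\<lambda>n. B * norm x ^ n"])
    show "summable (\<lambda>n. B * norm x ^ n)" using assms by (intro summable_mult summable_geometric) simp
    show "norm (norm (qpoch \<alpha> q n / qpoch q q n * x ^ n)) \<le> B * norm x ^ n" for n
      using mult_right_mono[OF B[of n], of "norm x ^ n"] by (simp add: norm_mult norm_power norm_divide)
  qed
qed

text \<open>
  The recurrence of the coefficients says that the sum \<open>F\<close> satisfies \<open>(1 - x) F(x) = (1 - \<alpha>x) F(xq)\<close>.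
  Iterating moves the argument to \<open>xq\<^sup>n\<close>, and \<open>F\<close> is continuous at \<open>0\<close> with value \<open>1\<close>.
\<close>
lemma qbinomial_theorem:
  assumes x: "norm x < 1"
  shows "(\<lambda>n. qpoch \<alpha> q n / qpoch q q n * x ^ n) sums (qpoch_inf (\<alpha> * x) q / qpoch_inf x q)"
proof -
  define c where "c n = qpoch \<alpha> q n / qpoch q q n" for n
  define F where "F x = (\<Sum>n. c n * x ^ n)" for x
  have sm: "summable (\<lambda>n. c n * x ^ n)" if "norm x < 1" for x
    using summable_qbinomial_series[OF that, of \<alpha>] unfolding c_def by (rule summable_norm_cancel)
  have c0: "c 0 = 1" by (simp add: c_def)
  have cS: "c (Suc n) * (1 - q ^ Suc n) = c n * (1 - \<alpha> * q ^ n)" for n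
    using q by (simp add: c_def qpoch_Suc field_simps qq_factor_neq_1 qq_nz)
  have fe: "(1 - x) * F x = (1 - \<alpha> * x) * F (x * q)" if x: "norm x < 1" for x
  proof -
    have xq: "norm (x * q) < 1" using norm_mult_qpow_less[OF q x, of 1] by simp
    have s0: "(\<lambda>n. c n * y ^ n) sums F y" if "norm y < 1" for y
      using sm[OF that] unfolding F_def by (rule summable_sums)
    have s1: "(\<lambda>n. c (Suc n) * y ^ Suc n) sums (F y - 1)" if "norm y < 1" for y
      using s0[OF that] c0 by (subst sums_Suc_iff) simp
    have "(\<lambda>n. c (Suc n) * x ^ Suc n - x * (c n * x ^ n) - c (Suc n) * (x * q) ^ Suc n
              + \<alpha> * x * (c n * (x * q) ^ n)) sums
          ((F x - 1) - x * F x - (F (x * q) - 1) + \<alpha> * x * F (x * q))"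
      by (intro sums_add sums_diff sums_mult s0 s1 x xq)
    moreover have "c (Suc n) * x ^ Suc n - x * (c n * x ^ n) - c (Suc n) * (x * q) ^ Suc n
              + \<alpha> * x * (c n * (x * q) ^ n)
        = x ^ Suc n * (c (Suc n) * (1 - q ^ Suc n) - c n * (1 - \<alpha> * q ^ n))" for n
      by (simp add: power_mult_distrib algebra_simps)
    ultimately have "(\<lambda>n. 0) sums ((F x - 1) - x * F x - (F (x * q) - 1) + \<alpha> * x * F (x * q))"
      unfolding cS by simp
    then have "(F x - 1) - x * F x - (F (x * q) - 1) + \<alpha> * x * F (x * q) = 0"
      by (rule sums_unique2[OF _ sums_zero])
    then show ?thesis by (simp add: algebra_simps)
  qed
  have it: "qpoch x q n * F x = qpoch (\<alpha> * x) q n * F (x * q ^ n)" for n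
  proof (induction n)
    case (Suc n)
    have "norm (x * q ^ n) < 1" by (rule norm_mult_qpow_less[OF q x])
    from fe[OF this] have "(1 - x * q ^ n) * F (x * q ^ n) = (1 - \<alpha> * x * q ^ n) * F (x * q ^ Suc n)"
      by (simp add: mult_ac)
    with Suc show ?case unfolding qpoch_Suc by (metis mult.assoc mult.commute)
  qed simp
  have "isCont F 0"
    unfolding F_def by (rule isCont_powser[of _ "1/2"]) (auto intro: sm)
  moreover have "(\<lambda>n. x * q ^ n) \<longlonglongrightarrow> x * 0"
    by (intro tendsto_mult tendsto_const LIMSEQ_power_zero q)
  ultimately have "(\<lambda>n. F (x * q ^ n)) \<longlonglongrightarrow> F 0" using isCont_tendsto_compose by fastforce
  moreover have "F 0 = 1" using c0 by (simp add: F_def)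
  ultimately have "(\<lambda>n. qpoch (\<alpha> * x) q n * F (x * q ^ n)) \<longlonglongrightarrow> qpoch_inf (\<alpha> * x) q * 1"
    by (intro tendsto_mult qpoch_tendsto[OF q]) simp
  moreover have "(\<lambda>n. qpoch x q n * F x) \<longlonglongrightarrow> qpoch_inf x q * F x"
    by (intro tendsto_mult qpoch_tendsto[OF q] tendsto_const)
  ultimately have "qpoch_inf x q * F x = qpoch_inf (\<alpha> * x) q"
    unfolding it by (metis LIMSEQ_unique mult.right_neutral)
  then have "F x = qpoch_inf (\<alpha> * x) q / qpoch_inf x q"
    using qpoch_inf_nz[OF q x] by (simp add: field_simps)
  then show ?thesis using summable_sums[OF sm[OF x]] by (simp add: F_def c_def)
qed

end

section \<open>A finite form of the Jacobi triple product\<close>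

lemma sum_powers_times_linear:
  fixes A B :: "nat \<Rightarrow> 'a :: comm_ring_1"
  assumes "A (Suc N) = 0" "B 0 = v * A 0" "\<And>i. i \<le> N \<Longrightarrow> B (Suc i) = v * A (Suc i) + u * A i"
  shows "(\<Sum>i\<le>Suc N. B i * x ^ i) = (\<Sum>i\<le>N. A i * x ^ i) * (v + u * x)"
proof -
  have "(\<Sum>i\<le>Suc N. B i * x ^ i) = v * A 0 + (\<Sum>i\<le>N. (v * A (Suc i) + u * A i) * x ^ Suc i)"
    by (subst sum.atMost_Suc_shift) (simp add: assms)
  also have "\<dots> = v * (A 0 + (\<Sum>i\<le>N. A (Suc i) * x ^ Suc i)) + u * x * (\<Sum>i\<le>N. A i * x ^ i)"
    by (simp add: sum.distrib sum_distrib_left algebra_simps)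
  also have "A 0 + (\<Sum>i\<le>N. A (Suc i) * x ^ Suc i) = (\<Sum>i\<le>N. A i * x ^ i)"
    using sum.atMost_Suc_shift[of "\<lambda>i. A i * x ^ i" N] assms(1) by simp
  finally show ?thesis by (simp add: algebra_simps)
qed

text \<open>
  The coefficient \<open>(-1)^k q^(k(k-1)/2)\<close> of \<open>x\<^sup>k\<close> in Jacobi's theta series, for positive and negative \<open>k\<close>. Since \<open>k(k-1)\<close> is
  never negative, natural exponents suffice, and the value at \<open>q = 0\<close> is the right one.
\<close>
definition theta_coeff :: "complex \<Rightarrow> int \<Rightarrow> complex" where
  "theta_coeff q k = (-1) ^ nat \<bar>k\<bar> * q ^ nat (k * (k - 1) div 2)"

lemma theta_coeff_step:
  assumes "int m + k \<ge> 0"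
  shows "q ^ m * theta_coeff q (k + 1) = - (q ^ nat (int m + k)) * theta_coeff q k"
proof -
  have ge: "k * (k - 1) \<ge> 0" by (cases "k \<le> 0") (auto simp: zero_le_mult_iff)
  have "(k + 1) * k = k * (k - 1) + k * 2" by (simp add: algebra_simps)
  then have "(k + 1) * k div 2 = k * (k - 1) div 2 + k" by simp
  moreover have "k * (k - 1) div 2 \<ge> 0" "(k + 1) * k div 2 \<ge> 0"
    using ge by (auto simp: pos_imp_zdiv_nonneg_iff zero_le_mult_iff)
  ultimately have "m + nat ((k + 1) * k div 2) = nat (int m + k) + nat (k * (k - 1) div 2)"
    using assms by linarith
  then have pw: "q ^ m * q ^ nat ((k + 1) * k div 2) = q ^ nat (int m + k) * q ^ nat (k * (k - 1) div 2)"
    by (metis power_add)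
  have "(-1 :: complex) ^ nat \<bar>k + 1\<bar> = - ((-1) ^ nat \<bar>k\<bar>)"
    by (simp add: minus_one_power_iff even_nat_iff)
  with pw show ?thesis by (simp add: theta_coeff_def algebra_simps)
qed

context
  fixes q :: complex
  assumes q: "norm q < 1"
begin

text \<open>
  Both sides are multiplied by \<open>x\<^sup>n\<close>, which keeps them polynomials. Adding a factor \<open>1 - xq\<^sup>m\<close> or
  \<open>x - q\<^sup>n\<^sup>+\<^sup>1\<close> acts on the coefficients as one or the other Pascal rule. The identity serves twice: its limit gives
  the Fourier coefficients of the theta function, and at \<open>x = 1\<close> it gives the orthogonality relation.
\<close>
lemma finite_triple_product:
  "(\<Sum>i\<le>m + n. (qbinom q (m + n) i * theta_coeff q (int i - int n)) * x ^ i)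
     = qpoch x q m * (\<Prod>l<n. x - q ^ Suc l)"
proof (induction n)
  case 0
  show ?case
  proof (induction m)
    case 0
    show ?case by (simp add: theta_coeff_def qbinom_def)
  next
    case (Suc m)
    have "(\<Sum>i\<le>Suc m. (qbinom q (Suc m) i * theta_coeff q (int i)) * x ^ i)
        = (\<Sum>i\<le>m. (qbinom q m i * theta_coeff q (int i)) * x ^ i) * (1 + (- (q ^ m)) * x)"
    proof (rule sum_powers_times_linear)
      fix i assume i: "i \<le> m"
      have E: "theta_coeff q (int (Suc i)) = - (q ^ i) * theta_coeff q (int i)"
        using theta_coeff_step[of 0 "int i" q] by (simp add: add.commute)
      have pw: "q ^ m = q ^ (m - i) * q ^ i" using i by (metis le_add_diff_inverse2 power_add)
      show "qbinom q (Suc m) (Suc i) * theta_coeff q (int (Suc i)) =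
          1 * (qbinom q m (Suc i) * theta_coeff q (int (Suc i))) + - (q ^ m) * (qbinom q m i * theta_coeff q (int i))"
        unfolding qbinom_Suc_Suc'[OF q] E pw by algebra
    qed (simp_all add: q)
    then show ?case using Suc by (simp add: qpoch_Suc algebra_simps)
  qed
next
  case (Suc n)
  have "(\<Sum>i\<le>Suc (m + n). (qbinom q (Suc (m + n)) i * theta_coeff q (int i - int (Suc n))) * x ^ i)
      = (\<Sum>i\<le>m + n. (qbinom q (m + n) i * theta_coeff q (int i - int n)) * x ^ i) * (- (q ^ Suc n) + 1 * x)"
  proof (rule sum_powers_times_linear)
    show "qbinom q (Suc (m + n)) 0 * theta_coeff q (int 0 - int (Suc n)) =
      - (q ^ Suc n) * (qbinom q (m + n) 0 * theta_coeff q (int 0 - int n))"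
      using theta_coeff_step[of "Suc n" "- int (Suc n)" q] by (simp add: q)
  next
    fix i assume i: "i \<le> m + n"
    have sh: "int (Suc i) - int (Suc n) = int i - int n" by simp
    have "q ^ Suc n * theta_coeff q (int (Suc i) - int n)
        = - (q ^ Suc i) * theta_coeff q (int (Suc i) - int (Suc n))"
      using theta_coeff_step[of "Suc n" "int (Suc i) - int (Suc n)" q]
      by (simp add: nat_add_distrib algebra_simps del: power_Suc)
    moreover have "(b + B * c) * T = - A * (c * E) + 1 * (b * T)" if "A * E = - B * T"
      for A B E T b c :: complex
      using that by algebra
    ultimately show "qbinom q (Suc (m + n)) (Suc i) * theta_coeff q (int (Suc i) - int (Suc n)) =
        - (q ^ Suc n) * (qbinom q (m + n) (Suc i) * theta_coeff q (int (Suc i) - int n)) +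
        1 * (qbinom q (m + n) i * theta_coeff q (int i - int n))"
      unfolding qbinom_Suc_Suc[OF q] sh by blast
  qed (simp_all add: q)
  then show ?case using Suc by (simp add: algebra_simps)
qed

end

section \<open>The kernel and its q-derivatives\<close>

lemma double_series_diagonal:
  fixes t :: "nat \<Rightarrow> nat \<Rightarrow> complex"
  assumes r: "0 \<le> r" "r < 1" and t: "\<And>i j. norm (t i j) \<le> M * r ^ i * r ^ j"
  shows "(\<lambda>n. \<Sum>j\<le>n. t (n - j) j) sums (\<Sum>j. \<Sum>i. t i j)"
    and "summable (\<lambda>j. \<Sum>i. t i j)"
proof -
  define f where "f = (\<lambda>(j, i). t i j)"
  have geo: "summable (\<lambda>i. c * r ^ i)" for c
    using r by (intro summable_mult summable_geometric) simp
  have M0: "0 \<le> M" using t[of 0 0] norm_ge_zero order_trans by (simp, blast)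
  have row: "((\<lambda>i. M * r ^ j * r ^ i) has_sum (M * r ^ j) * (1 / (1 - r))) UNIV" for j
    using r M0 sums_mult[OF geometric_sums[of r], of "M * r ^ j"]
    by (intro norm_summable_imp_has_sum) (auto intro: geo)
  have "(\<lambda>j. (M * r ^ j) * (1 / (1 - r))) summable_on UNIV"
    using r M0 geo[of "M * (1 / (1 - r))"] by (intro norm_summable_imp_summable_on) (simp add: mult_ac)
  then have g: "(\<lambda>(j, i). M * r ^ j * r ^ i) summable_on (UNIV \<times> UNIV)"
    using row r M0 by (intro summable_on_SigmaI) auto
  have "norm (f p) \<le> (case p of (j, i) \<Rightarrow> M * r ^ j * r ^ i)" for p
    using t[of "snd p" "fst p"] by (cases p) (simp add: f_def mult_ac)
  then have "(\<lambda>p. norm (f p)) summable_on (UNIV \<times> UNIV)"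
    by (intro Infinite_Sum.abs_summable_on_comparison_test'[OF g])
  then have "f summable_on (UNIV \<times> UNIV)" by (rule abs_summable_summable)
  then obtain S where S: "(f has_sum S) (UNIV \<times> UNIV)" by (auto simp: summable_on_def)
  have "((\<lambda>i. f (j, i)) has_sum (\<Sum>i. t i j)) UNIV" for j
  proof -
    have "summable (\<lambda>i. norm (t i j))"
      by (rule summable_comparison_test'[OF geo[of "M * r ^ j"]]) (use t in \<open>auto simp: mult_ac\<close>)
    from norm_summable_imp_has_sum[OF this summable_sums[OF summable_norm_cancel[OF this]]]
    show ?thesis by (simp add: f_def)
  qed
  from has_sum_SigmaD[OF S this] have rows: "((\<lambda>j. \<Sum>i. t i j) has_sum S) UNIV" .
  have "((\<lambda>p. t (fst p - snd p) (snd p)) has_sum S) (SIGMA n:UNIV. {..n}) \<longleftrightarrow> (f has_sum S) (UNIV \<times> UNIV)"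
    by (rule has_sum_reindex_bij_witness[where i = "\<lambda>(j, i). (i + j, j)" and j = "\<lambda>(n, j). (j, n - j)"])
       (auto simp: f_def)
  then have "((\<lambda>p. t (fst p - snd p) (snd p)) has_sum S) (SIGMA n:UNIV. {..n})" using S by simp
  then have "((\<lambda>n. \<Sum>j\<le>n. t (n - j) j) has_sum S) UNIV"
    by (rule has_sum_SigmaD) (auto intro!: has_sum_finiteI)
  then have "(\<lambda>n. \<Sum>j\<le>n. t (n - j) j) sums S" by (rule has_sum_imp_sums)
  moreover have "S = (\<Sum>j. \<Sum>i. t i j)" using has_sum_imp_sums[OF rows] by (simp add: sums_iff)
  ultimately show "(\<lambda>n. \<Sum>j\<le>n. t (n - j) j) sums (\<Sum>j. \<Sum>i. t i j)" by simp
  show "summable (\<lambda>j. \<Sum>i. t i j)"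
    using has_sum_imp_sums[OF rows] by (rule sums_summable)
qed

definition qkernel :: "complex \<Rightarrow> complex \<Rightarrow> complex \<Rightarrow> complex \<Rightarrow> complex \<Rightarrow> complex" where
  "qkernel q a s t u = qpoch_inf (a * t * u) q / (qpoch_inf (a * s) q * qpoch_inf (a * t) q)"

text \<open>
  The sum \<open>R\<^sub>n\<close>, that is the quotient of the \<open>n\<close>-th \<open>q\<close>-derivative of \<open>qkernel\<close> in \<open>a\<close> by \<open>qkernel\<close> itself. At
  \<open>a = u = 0\<close>, \<open>s = z\<close>, \<open>t = 1/z\<close> it is the continuous \<open>q\<close>-Hermite polynomial.
\<close>
definition qderiv_ratio :: "complex \<Rightarrow> nat \<Rightarrow> complex \<Rightarrow> complex \<Rightarrow> complex \<Rightarrow> complex \<Rightarrow> complex" where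
  "qderiv_ratio q n a s t u = (\<Sum>j\<le>n. qbinom q n j *
     (qpoch (a * s) q j * qpoch u q j / qpoch (a * t * u) q j * t ^ j * s ^ (n - j)))"

text \<open>
  The function \<open>(fgs)/(gs) \<^sub>3\<phi>\<^sub>2[f, as, u; fgs, atu; q, gt]\<close>, where the quotients \<open>(fgs;q)\<^sub>\<infinity>/(fgs;q)\<^sub>j\<close> have been
  replaced by \<open>(fgsq\<^sup>j;q)\<^sub>\<infinity>\<close>. In this form it makes sense for all values of \<open>fgs\<close>.
\<close>
definition phi32_reg :: "complex \<Rightarrow> complex \<Rightarrow> complex \<Rightarrow> complex \<Rightarrow> complex \<Rightarrow> complex \<Rightarrow> complex \<Rightarrow> complex" where
  "phi32_reg q f g a s t u = (\<Sum>j. qpoch f q j * qpoch (a * s) q j * qpoch u q j /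
     (qpoch q q j * qpoch (a * t * u) q j) * (g * t) ^ j *
     (qpoch_inf (f * g * s * q ^ j) q / qpoch_inf (g * s) q))"

lemma norm_mult_less_one:
  fixes x y :: "'a :: real_normed_algebra"
  assumes "norm x < 1" "norm y \<le> 1" shows "norm (x * y) < 1"
  using assms by (meson mult_left_le norm_ge_zero norm_mult_ineq order_le_less_trans)

context
  fixes q :: complex
  assumes q: "norm q < 1"
begin

lemma qbinom_sum_Suc:
  "(\<Sum>j\<le>Suc n. qbinom q (Suc n) j * Z j) = (\<Sum>j\<le>n. qbinom q n j * (q ^ j * Z j + Z (Suc j)))"
proof -
  have "(\<Sum>j\<le>Suc n. qbinom q (Suc n) j * Z j)
      = Z 0 + (\<Sum>j\<le>n. (q ^ Suc j * qbinom q n (Suc j)) * Z (Suc j)) + (\<Sum>j\<le>n. qbinom q n j * Z (Suc j))"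
    by (subst sum.atMost_Suc_shift)
       (simp add: qbinom_Suc_Suc[OF q] sum.distrib distrib_right q del: power_Suc)
  also have "Z 0 + (\<Sum>j\<le>n. (q ^ Suc j * qbinom q n (Suc j)) * Z (Suc j)) = (\<Sum>j\<le>n. (q ^ j * qbinom q n j) * Z j)"
    using sum.atMost_Suc_shift[of "\<lambda>j. (q ^ j * qbinom q n j) * Z j" n] by (simp add: q)
  finally show ?thesis by (simp add: sum.distrib algebra_simps)
qed

lemma qderiv_ratio_0 [simp]: "qderiv_ratio q 0 a s t u = 1"
  by (simp add: qderiv_ratio_def q)

text \<open>
  Passing from \<open>a\<close> to \<open>aq\<close> multiplies the kernel and each term of \<open>R\<^sub>n\<close> by explicit linear factors, so the
  difference can be compared term by term with \<open>R\<^sub>n\<^sub>+\<^sub>1\<close> after a Pascal rule. What remains is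
  the polynomial identity
  \<open>(1 - atuQ) - (1 - at)(1 - asQ) = a (sQ (1 - atuQ) + t (1 - uQ)(1 - asQ))\<close> with \<open>Q = q\<^sup>j\<close>.
\<close>
lemma qkernel_qdifference:
  assumes a: "norm a < 1" and s: "norm s \<le> 1" and t: "norm t \<le> 1" and u: "norm u \<le> 1"
  shows "qkernel q a s t u * qderiv_ratio q n a s t u - qkernel q (a * q) s t u * qderiv_ratio q n (a * q) s t u
           = a * (qkernel q a s t u * qderiv_ratio q (Suc n) a s t u)"
proof -
  define v where "v = a * t * u"
  have v: "norm v < 1" using a t u by (simp add: v_def norm_mult_less_one)
  have vf: "1 - v * q ^ j \<noteq> 0" for j by (rule qfactor_nz[OF q v])
  have vn: "qpoch v q j \<noteq> 0" for j by (rule qpoch_nz[OF q v])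
  define Y where "Y j = qpoch (a * s) q j * qpoch u q j / qpoch v q j * t ^ j" for j
  define k where "k = qkernel q a s t u"
  define W where "W j = qbinom q n j * (Y j * s ^ (n - j))" for j
  have Y_Suc: "Y (Suc j) = Y j * ((1 - a * s * q ^ j) * (1 - u * q ^ j) * t / (1 - v * q ^ j))" for j
    by (simp add: Y_def qpoch_Suc)
  have R: "qderiv_ratio q n a s t u = sum W {..n}"
    by (simp add: qderiv_ratio_def W_def Y_def v_def)
  have "qderiv_ratio q (Suc n) a s t u = (\<Sum>j\<le>Suc n. qbinom q (Suc n) j * (Y j * s ^ (Suc n - j)))"
    by (simp add: qderiv_ratio_def Y_def v_def)
  also have "\<dots> = (\<Sum>j\<le>n. qbinom q n j * (q ^ j * (Y j * s ^ (Suc n - j)) + Y (Suc j) * s ^ (n - j)))"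
    by (subst qbinom_sum_Suc) simp
  also have "\<dots> = (\<Sum>j\<le>n. W j * (q ^ j * s + (1 - a * s * q ^ j) * (1 - u * q ^ j) * t / (1 - v * q ^ j)))"
    by (intro sum.cong refl) (simp add: Y_Suc W_def Suc_diff_le algebra_simps)
  finally have RS: "qderiv_ratio q (Suc n) a s t u = \<dots>" .
  have "k * (1 - a * t) * (1 - a * s) / (1 - v) = qkernel q (a * q) s t u"
  proof -
    have nz: "1 - a * s \<noteq> 0" "1 - a * t \<noteq> 0" "1 - v \<noteq> 0"
      using norm_mult_less_one[OF a s] norm_mult_less_one[OF a t] v by auto
    show ?thesis
      unfolding k_def qkernel_def qpoch_inf_step[OF q, of "a * t * u"] qpoch_inf_step[OF q, of "a * s"]
        qpoch_inf_step[OF q, of "a * t"]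
      using nz by (simp add: v_def mult_ac)
  qed
  moreover have "qderiv_ratio q n (a * q) s t u =
     (\<Sum>j\<le>n. W j * ((1 - a * s * q ^ j) / (1 - v * q ^ j)) * ((1 - v) / (1 - a * s)))"
    unfolding qderiv_ratio_def
  proof (intro sum.cong refl)
    fix j
    have as: "1 - a * s \<noteq> 0" using norm_mult_less_one[OF a s] by auto
    have v1: "1 - v \<noteq> 0" using vf[of 0] by simp
    have "qpoch (a * s * q) q j = qpoch (a * s) q j * (1 - a * s * q ^ j) / (1 - a * s)"
      using as qpoch_Suc_shift[of "a * s" q j] qpoch_Suc[of "a * s" q j] by (simp add: field_simps)
    moreover have "qpoch (v * q) q j = qpoch v q j * (1 - v * q ^ j) / (1 - v)"
      using v1 qpoch_Suc_shift[of v q j] qpoch_Suc[of v q j] by (simp add: field_simps)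
    ultimately show "qbinom q n j * (qpoch (a * q * s) q j * qpoch u q j / qpoch (a * q * t * u) q j * t ^ j * s ^ (n - j))
      = W j * ((1 - a * s * q ^ j) / (1 - v * q ^ j)) * ((1 - v) / (1 - a * s))"
      by (simp add: W_def Y_def v_def mult_ac)
  qed
  ultimately have "qkernel q (a * q) s t u * qderiv_ratio q n (a * q) s t u
     = k * (1 - a * t) * (1 - a * s) / (1 - v) *
       ((\<Sum>j\<le>n. W j * ((1 - a * s * q ^ j) / (1 - v * q ^ j))) * ((1 - v) / (1 - a * s)))"
    by (simp only: sum_distrib_right)
  also have "\<dots> = k * (1 - a * t) * (\<Sum>j\<le>n. W j * ((1 - a * s * q ^ j) / (1 - v * q ^ j)))"
  proof -
    have "1 - a * s \<noteq> 0" "1 - v \<noteq> 0" using norm_mult_less_one[OF a s] v by auto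
    then show ?thesis by simp
  qed
  finally have "qkernel q a s t u * qderiv_ratio q n a s t u - qkernel q (a * q) s t u * qderiv_ratio q n (a * q) s t u
     = k * (\<Sum>j\<le>n. W j * (1 - (1 - a * t) * ((1 - a * s * q ^ j) / (1 - v * q ^ j))))"
    by (simp add: R k_def[symmetric] sum_subtractf sum_distrib_left right_diff_distrib mult_ac)
  also have "\<dots> = k * (\<Sum>j\<le>n. a * (W j * (q ^ j * s + (1 - a * s * q ^ j) * (1 - u * q ^ j) * t / (1 - v * q ^ j))))"
  proof -
    have "W j * (1 - (1 - a * t) * ((1 - a * s * q ^ j) / (1 - v * q ^ j)))
        = a * (W j * (q ^ j * s + (1 - a * s * q ^ j) * (1 - u * q ^ j) * t / (1 - v * q ^ j)))" for j
    proof -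
    have gen: "(1 - A * (B / D)) * D = D - A * B" if "D \<noteq> 0" for A B D :: complex
      using that by (simp add: field_simps)
    have "(1 - (1 - a * t) * ((1 - a * s * q ^ j) / (1 - v * q ^ j))) * (1 - v * q ^ j)
        = (1 - v * q ^ j) - (1 - a * t) * (1 - a * s * q ^ j)"
      using gen[OF vf[of j]] by blast
    also have "\<dots> = a * (q ^ j * s * (1 - v * q ^ j) + (1 - a * s * q ^ j) * (1 - u * q ^ j) * t)"
      by (simp add: v_def algebra_simps)
    also have "\<dots> = a * (q ^ j * s + (1 - a * s * q ^ j) * (1 - u * q ^ j) * t / (1 - v * q ^ j)) * (1 - v * q ^ j)"
      using vf[of j] by (simp add: distrib_left distrib_right)
    finally have "1 - (1 - a * t) * ((1 - a * s * q ^ j) / (1 - v * q ^ j))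
        = a * (q ^ j * s + (1 - a * s * q ^ j) * (1 - u * q ^ j) * t / (1 - v * q ^ j))"
      using mult_right_cancel[OF vf[of j]] by blast
    then show ?thesis by (simp only: mult.left_commute)
    qed
    then show ?thesis by (simp only:)
  qed
  finally show ?thesis by (simp only: RS k_def sum_distrib_left mult_ac)
qed

lemma qcoeff_bounded:
  assumes v: "norm v < 1"
  obtains B where "B \<ge> 0"
    "\<And>x u j. norm x \<le> 1 \<Longrightarrow> norm u \<le> 1 \<Longrightarrow> norm (qpoch x q j * qpoch u q j / qpoch v q j) \<le> B"
proof -
  define E where "E = exp (1 / (1 - norm q))"
  obtain I where I: "I \<ge> 0" "\<And>n. norm (inverse (qpoch v q n)) \<le> I"
    using inverse_qpoch_bounded[OF q v] by blast
  have "norm (qpoch x q j * qpoch u q j / qpoch v q j) \<le> E * E * I"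
    if "norm x \<le> 1" "norm u \<le> 1" for x u j
    unfolding divide_inverse[of "qpoch x q j * qpoch u q j"] norm_mult E_def
    by (intro mult_mono norm_qpoch_le[OF q] I that mult_nonneg_nonneg) auto
  then show ?thesis using that[of "E * E * I"] I by (auto simp: E_def)
qed

lemma qderiv_ratio_bounded:
  assumes v: "norm v < 1"
  obtains B where "B \<ge> 0"
    "\<And>n a s t u. norm a < 1 \<Longrightarrow> norm s \<le> 1 \<Longrightarrow> norm t \<le> 1 \<Longrightarrow> norm u \<le> 1 \<Longrightarrow> a * t * u = v \<Longrightarrow>
       norm (qderiv_ratio q n a s t u) \<le> B * real (Suc n)"
proof -
  obtain B where B: "B \<ge> 0"
    "\<And>x u j. norm x \<le> 1 \<Longrightarrow> norm u \<le> 1 \<Longrightarrow> norm (qpoch x q j * qpoch u q j / qpoch v q j) \<le> B"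
    using qcoeff_bounded[OF v] by blast
  obtain M where M: "M \<ge> 0" "\<And>n k. norm (qbinom q n k) \<le> M" using qbinom_bounded[OF q] by blast
  have "norm (qderiv_ratio q n a s t u) \<le> (M * B) * real (Suc n)"
    if h: "norm a < 1" "norm s \<le> 1" "norm t \<le> 1" "norm u \<le> 1" "a * t * u = v" for n a s t u
  proof -
    have "norm (qderiv_ratio q n a s t u) \<le> (\<Sum>j\<le>n. M * (B * 1 * 1))"
      unfolding qderiv_ratio_def h(5)
    proof (rule sum_norm_le)
      fix j
      have "norm (a * s) \<le> 1" using norm_mult_less_one[OF h(1,2)] by simp
      then show "norm (qbinom q n j * (qpoch (a * s) q j * qpoch u q j / qpoch v q j * t ^ j * s ^ (n - j)))
          \<le> M * (B * 1 * 1)"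
        unfolding norm_mult[of "qbinom q n j"] norm_mult[of _ "s ^ (n - j)"] norm_mult[of _ "t ^ j"] norm_power
        using h B M by (intro mult_mono power_le_one mult_nonneg_nonneg) auto
    qed
    then show ?thesis by (simp add: mult_ac)
  qed
  then show ?thesis using that[of "M * B"] M B by simp
qed

text \<open>
  Since \<open>(f;q)\<^sub>i\<^sub>+\<^sub>j = (f;q)\<^sub>j (fq\<^sup>j;q)\<^sub>i\<close>, the series over \<open>n = i + j\<close> is the diagonal summation of a double series
  whose sums over \<open>i\<close> are given by the \<open>q\<close>-binomial theorem.
\<close>
lemma phi32_reg_sums:
  assumes g: "norm g < 1" and a: "norm a < 1" and s: "norm s \<le> 1" and t: "norm t \<le> 1" and u: "norm u \<le> 1"
  shows "(\<lambda>n. qpoch f q n / qpoch q q n * g ^ n * qderiv_ratio q n a s t u) sums phi32_reg q f g a s t u"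
    and "summable (\<lambda>j. qpoch f q j * qpoch (a * s) q j * qpoch u q j /
           (qpoch q q j * qpoch (a * t * u) q j) * (g * t) ^ j *
           (qpoch_inf (f * g * s * q ^ j) q / qpoch_inf (g * s) q))"
proof -
  define v where "v = a * t * u"
  have v: "norm v < 1" using a t u by (simp add: v_def norm_mult_less_one)
  define Y where "Y j = qpoch (a * s) q j * qpoch u q j / qpoch v q j" for j
  define T where "T i j = qpoch f q (i + j) * (inverse (qpoch q q i) * inverse (qpoch q q j)) * Y j * (g * s) ^ i * (g * t) ^ j" for i j
  obtain B where B: "B \<ge> 0"
    "\<And>x u j. norm x \<le> 1 \<Longrightarrow> norm u \<le> 1 \<Longrightarrow> norm (qpoch x q j * qpoch u q j / qpoch v q j) \<le> B"
    using qcoeff_bounded[OF v] by blast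
  obtain I where I: "I \<ge> 0" "\<And>n. norm (inverse (qpoch q q n)) \<le> I"
    using inverse_qpoch_bounded[OF q q] by blast
  define E where "E = exp (norm f / (1 - norm q))"
  have Tb: "norm (T i j) \<le> (E * (I * I) * B) * norm g ^ i * norm g ^ j" for i j
  proof -
    have "norm (a * s) \<le> 1" using norm_mult_less_one[OF a s] by simp
    then have "norm (Y j) \<le> B" unfolding Y_def using B u by blast
    moreover have "norm (g * s) \<le> norm g" "norm (g * t) \<le> norm g"
      using s t by (auto simp: norm_mult intro: mult_left_le)
    ultimately show ?thesis
      unfolding T_def norm_mult[of _ "(g * t) ^ j"] norm_mult[of _ "(g * s) ^ i"] norm_mult[of _ "Y j"]
        norm_mult[of _ "inverse (qpoch q q i) * inverse (qpoch q q j)"]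
        norm_mult[of "inverse (qpoch q q i)"] norm_power E_def
      using B I by (intro mult_mono power_mono norm_qpoch_le[OF q] mult_nonneg_nonneg) auto
  qed
  have row: "(\<Sum>i. T i j) = qpoch f q j * qpoch (a * s) q j * qpoch u q j /
           (qpoch q q j * qpoch v q j) * (g * t) ^ j *
           (qpoch_inf (f * g * s * q ^ j) q / qpoch_inf (g * s) q)" (is "_ = ?c * _ ") for j
  proof -
    have "norm (g * s) < 1" using g s by (rule norm_mult_less_one)
    from sums_mult[OF qbinomial_theorem[OF q this, of "f * q ^ j"], of ?c]
    have "(\<lambda>i. ?c * (qpoch (f * q ^ j) q i / qpoch q q i * (g * s) ^ i)) sums
        (?c * (qpoch_inf (f * g * s * q ^ j) q / qpoch_inf (g * s) q))"
      by (simp add: mult_ac)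
    moreover have "?c * (qpoch (f * q ^ j) q i / qpoch q q i * (g * s) ^ i) = T i j" for i
      using qpoch_add[of f q j i] by (simp add: T_def Y_def divide_inverse add.commute mult_ac)
    ultimately show ?thesis by (simp add: sums_iff)
  qed
  have diag: "(\<Sum>j\<le>n. T (n - j) j) = qpoch f q n / qpoch q q n * g ^ n * qderiv_ratio q n a s t u" for n
    unfolding qderiv_ratio_def sum_distrib_left
  proof (intro sum.cong refl)
    fix j assume "j \<in> {..n}"
    then have j: "j \<le> n" by simp
    have "g ^ n = g ^ (n - j) * g ^ j" using j by (metis le_add_diff_inverse2 power_add)
    with j show "T (n - j) j = qpoch f q n / qpoch q q n * g ^ n * (qbinom q n j *
        (qpoch (a * s) q j * qpoch u q j / qpoch (a * t * u) q j * t ^ j * s ^ (n - j)))"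
      using q by (simp add: T_def Y_def v_def qbinom_def power_mult_distrib field_simps qq_nz)
  qed
  note D = double_series_diagonal[OF norm_ge_zero g Tb]
  show "(\<lambda>n. qpoch f q n / qpoch q q n * g ^ n * qderiv_ratio q n a s t u) sums phi32_reg q f g a s t u"
    using D(1) unfolding diag row by (simp add: phi32_reg_def v_def)
  show "summable (\<lambda>j. qpoch f q j * qpoch (a * s) q j * qpoch u q j /
           (qpoch q q j * qpoch (a * t * u) q j) * (g * t) ^ j *
           (qpoch_inf (f * g * s * q ^ j) q / qpoch_inf (g * s) q))"
    using D(2) unfolding row by (simp add: v_def)
qed

lemma phi32_reg_eq_phi32:
  assumes g: "norm g < 1" and a: "norm a < 1" and s: "norm s \<le> 1" and t: "norm t \<le> 1" and u: "norm u \<le> 1"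
    and nz: "\<And>k. qpoch (f * g * s) q k \<noteq> 0"
  shows "phi32_reg q f g a s t u = qpoch_inf (f * g * s) q / qpoch_inf (g * s) q *
           phi32 f (a * s) u (f * g * s) (a * t * u) q (g * t)"
proof -
  define C where "C = qpoch_inf (f * g * s) q / qpoch_inf (g * s) q"
  define p where "p k = qpochs [f, a * s, u] q k / qpochs [q, f * g * s, a * t * u] q k * (g * t) ^ k" for k
  have "1 - f * g * s * q ^ k \<noteq> 0" for k using nz[of "Suc k"] by (simp add: qpoch_Suc)
  then have "qpoch_inf (f * g * s) q \<noteq> 0"
    unfolding qpoch_inf_def by (intro prodinf_nonzero convergent_prod_qpoch q)
  moreover have "qpoch_inf (g * s) q \<noteq> 0" using q norm_mult_less_one[OF g s] by (rule qpoch_inf_nz)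
  ultimately have C: "C \<noteq> 0" by (simp add: C_def)
  have e: "qpoch f q j * qpoch (a * s) q j * qpoch u q j /
           (qpoch q q j * qpoch (a * t * u) q j) * (g * t) ^ j *
           (qpoch_inf (f * g * s * q ^ j) q / qpoch_inf (g * s) q) = C * p j" for j
    using nz[of j] by (simp add: C_def p_def qpochs_def qpoch_inf_split[OF q, of "f * g * s" j])
      (simp add: mult_ac)
  have "summable (\<lambda>j. C * p j)" using phi32_reg_sums(2)[OF g a s t u, of f] unfolding e .
  then have "summable p" using C by (simp add: summable_cmult_iff)
  then have "(\<Sum>j. C * p j) = C * (\<Sum>j. p j)" by (rule suminf_mult)
  then show ?thesis unfolding phi32_reg_def e by (simp add: C_def p_def phi32_def)
qed

end

section \<open>The q-derivative under the integral sign\<close>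

lemma cis_mult_cis_uminus: "cis \<theta> * cis (- \<theta>) = 1"
  by (simp add: cis_mult)

lemma has_integral_suminf:
  fixes F :: "nat \<Rightarrow> real \<Rightarrow> complex"
  assumes F: "\<And>n. (F n has_integral c n) {\<alpha>..\<beta>}"
    and cont: "\<And>n. continuous_on {\<alpha>..\<beta>} (F n)"
    and bound: "\<And>n x. x \<in> {\<alpha>..\<beta>} \<Longrightarrow> norm (F n x) \<le> M n" and M: "summable M"
  shows "((\<lambda>x. \<Sum>n. F n x) has_integral (\<Sum>n. c n)) {\<alpha>..\<beta>}"
proof -
  have "uniform_limit {\<alpha>..\<beta>} (\<lambda>n x. \<Sum>k<n. F k x) (\<lambda>x. \<Sum>n. F n x) sequentially"
    using bound M by (rule Weierstrass_m_test)
  then obtain I J where I: "\<And>n. ((\<lambda>x. \<Sum>k<n. F k x) has_integral I n) {\<alpha>..\<beta>}"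
    and J: "((\<lambda>x. \<Sum>n. F n x) has_integral J) {\<alpha>..\<beta>}" "I \<longlonglongrightarrow> J"
    by (rule uniform_limit_integral) (auto intro!: continuous_intros cont)
  have "I = (\<lambda>n. \<Sum>k<n. c k)"
    by (rule ext, rule has_integral_unique[OF I]) (intro has_integral_sum F finite_lessThan)
  with J(2) have "c sums J" by (simp only: sums_def)
  then show ?thesis using J(1) by (simp add: sums_iff)
qed

context
  fixes q :: complex
  assumes q: "norm q < 1"
begin

lemma continuous_on_qkernel_qderiv_ratio:
  assumes cont: "continuous_on A \<alpha>" "continuous_on A s" "continuous_on A t" "continuous_on A u"
    and bd: "\<And>x. x \<in> A \<Longrightarrow> norm (\<alpha> x) < 1" "\<And>x. x \<in> A \<Longrightarrow> norm (s x) \<le> 1"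
      "\<And>x. x \<in> A \<Longrightarrow> norm (t x) \<le> 1" "\<And>x. x \<in> A \<Longrightarrow> norm (u x) \<le> 1"
  shows "continuous_on A (\<lambda>x. qkernel q (\<alpha> x) (s x) (t x) (u x))"
    and "continuous_on A (\<lambda>x. qderiv_ratio q n (\<alpha> x) (s x) (t x) (u x))"
proof -
  have "qpoch_inf (\<alpha> x * s x) q \<noteq> 0" "qpoch_inf (\<alpha> x * t x) q \<noteq> 0" if "x \<in> A" for x
    using that bd by (auto intro!: qpoch_inf_nz[OF q] norm_mult_less_one)
  then show "continuous_on A (\<lambda>x. qkernel q (\<alpha> x) (s x) (t x) (u x))"
    unfolding qkernel_def by (intro continuous_intros continuous_on_qpoch_inf[OF q] cont) auto
  have "qpoch (\<alpha> x * t x * u x) q j \<noteq> 0" if "x \<in> A" for x j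
    using that bd by (intro qpoch_nz[OF q] norm_mult_less_one) auto
  then show "continuous_on A (\<lambda>x. qderiv_ratio q n (\<alpha> x) (s x) (t x) (u x))"
    unfolding qderiv_ratio_def by (intro continuous_intros cont) auto
qed

text \<open>
  By induction on the order of the derivative: the identities at \<open>a\<close> and \<open>aq\<close> are subtracted and divided by
  \<open>a\<close>. The point \<open>a = 0\<close> is reached by continuity; it cannot be left out, because for \<open>q = 0\<close> the
  difference quotient at every \<open>a\<close> refers to it.
\<close>
lemma has_integral_qderiv_ratio:
  assumes K: "continuous_on {0..pi} K" and b: "norm b \<le> 1"
    and S: "norm S \<le> 1" and T: "norm T \<le> 1" and U: "norm U \<le> 1"
    and hyp: "\<And>a. norm a < 1 \<Longrightarrow>
      ((\<lambda>\<theta>. K \<theta> * qkernel q a (cis \<theta>) (cis (- \<theta>)) (b * cis \<theta>)) has_integral C * qkernel q a S T U) {0..pi}"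
    and a: "norm a < 1"
  shows "((\<lambda>\<theta>. K \<theta> * (qkernel q a (cis \<theta>) (cis (- \<theta>)) (b * cis \<theta>) * qderiv_ratio q n a (cis \<theta>) (cis (- \<theta>)) (b * cis \<theta>)))
           has_integral C * (qkernel q a S T U * qderiv_ratio q n a S T U)) {0..pi}"
  using a
proof (induction n arbitrary: a)
  case 0
  then show ?case using hyp by (simp add: q)
next
  case (Suc n)
  define G where "G a \<theta> = K \<theta> * (qkernel q a (cis \<theta>) (cis (- \<theta>)) (b * cis \<theta>) *
      qderiv_ratio q (Suc n) a (cis \<theta>) (cis (- \<theta>)) (b * cis \<theta>))" for a \<theta>
  define H where "H a = C * (qkernel q a S T U * qderiv_ratio q (Suc n) a S T U)" for a
  have nonzero: "(G a has_integral H a) {0..pi}" if a: "norm a < 1" and a0: "a \<noteq> 0" for a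
  proof -
    have aq: "norm (a * q) < 1" using norm_mult_qpow_less[OF q a, of 1] by simp
    from has_integral_mult_right[OF has_integral_diff[OF Suc.IH[OF a] Suc.IH[OF aq]], of "1 / a"]
    show ?thesis
    proof (rule has_integral_eq_rhs[OF has_integral_eq, rotated])
      fix \<theta> assume "\<theta> \<in> {0..pi}"
      have "norm (b * cis \<theta>) \<le> 1" using b by (simp add: norm_mult)
      from qkernel_qdifference[OF q a _ _ this, of "cis \<theta>" "cis (- \<theta>)" n]
      show "1 / a * (K \<theta> * (qkernel q a (cis \<theta>) (cis (- \<theta>)) (b * cis \<theta>) * qderiv_ratio q n a (cis \<theta>) (cis (- \<theta>)) (b * cis \<theta>)) -
          K \<theta> * (qkernel q (a * q) (cis \<theta>) (cis (- \<theta>)) (b * cis \<theta>) * qderiv_ratio q n (a * q) (cis \<theta>) (cis (- \<theta>)) (b * cis \<theta>)))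
          = G a \<theta>"
        unfolding right_diff_distrib[symmetric] using a0 by (simp add: G_def)
    next
      show "H a = 1 / a * (C * (qkernel q a S T U * qderiv_ratio q n a S T U) - C * (qkernel q (a * q) S T U * qderiv_ratio q n (a * q) S T U))"
        unfolding right_diff_distrib[symmetric] qkernel_qdifference[OF q a S T U] using a0 by (simp add: H_def)
    qed
  qed
  (* At a = 0 both sides are continuous in a, and they agree for all other small a. *)
  define D where "D a = integral {0..pi} (G a) - H a" for a
  have contG: "continuous_on (ball 0 1 \<times> {0..pi}) (\<lambda>(a, \<theta>). G a \<theta>)"
    unfolding G_def case_prod_beta using b
    by (intro continuous_intros continuous_on_compose2[OF K] continuous_on_qkernel_qderiv_ratio) (auto simp: norm_mult)
  have "continuous_on (ball 0 1) (\<lambda>a. integral {0..pi} (G a))"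
    using integral_continuous_on_param[of "ball 0 1" 0 pi G] contG by simp
  moreover have "continuous_on (ball 0 1) H"
    unfolding H_def using S T U by (intro continuous_intros continuous_on_qkernel_qderiv_ratio) auto
  ultimately have "continuous_on (ball 0 1) D" unfolding D_def by (intro continuous_intros)
  then have "D \<midarrow>0\<rightarrow> D 0" using continuous_on_interior[of "ball 0 1" D 0] by (simp add: isCont_def)
  moreover have "\<forall>\<^sub>F a in at 0. D a = 0"
    unfolding eventually_at using integral_unique[OF nonzero]
    by (intro exI[of _ 1]) (auto simp: D_def)
  then have "D \<midarrow>0\<rightarrow> 0" by (rule tendsto_eventually)
  ultimately have "D 0 = 0" using LIM_unique by blast
  moreover have "continuous_on {0..pi} (G a)"
    using continuous_on_compose2[OF contG continuous_on_Pair[OF continuous_on_const continuous_on_id], of a "{0..pi}"]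
      Suc.prems by (simp add: image_subset_iff)
  ultimately have "(G a has_integral H a) {0..pi}"
    using nonzero[OF Suc.prems] integrable_integral[OF integrable_continuous_interval, of 0 pi "G a"]
    by (cases "a = 0") (auto simp: D_def)
  then show ?case by (simp add: G_def[abs_def] H_def)
qed

text \<open>
  For fixed \<open>a\<close> and \<open>b\<close> the sums \<open>R\<^sub>n\<close> grow at most linearly in \<open>n\<close>, uniformly in \<open>\<theta>\<close>, because \<open>atu = ab\<close> does not
  depend on \<open>\<theta>\<close>. Hence the series in \<open>g\<close> may be integrated term by term.
\<close>
lemma has_integral_phi32_reg_of_moments:
  assumes K: "continuous_on {0..pi} K" and b: "norm b \<le> 1" and a: "norm a < 1" and g: "norm g < 1"
    and moments: "\<And>n. ((\<lambda>\<theta>. K \<theta> * (qkernel q a (cis \<theta>) (cis (- \<theta>)) (b * cis \<theta>) * qderiv_ratio q n a (cis \<theta>) (cis (- \<theta>)) (b * cis \<theta>)))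
           has_integral m n) {0..pi}"
  shows "((\<lambda>\<theta>. K \<theta> * (qkernel q a (cis \<theta>) (cis (- \<theta>)) (b * cis \<theta>) * phi32_reg q f g a (cis \<theta>) (cis (- \<theta>)) (b * cis \<theta>)))
           has_integral (\<Sum>n. qpoch f q n / qpoch q q n * g ^ n * m n)) {0..pi}"
proof -
  define w where "w \<theta> = K \<theta> * qkernel q a (cis \<theta>) (cis (- \<theta>)) (b * cis \<theta>)" for \<theta>
  define R where "R n \<theta> = qderiv_ratio q n a (cis \<theta>) (cis (- \<theta>)) (b * cis \<theta>)" for n \<theta>
  define e where "e n = qpoch f q n / qpoch q q n * g ^ n" for n
  have bz: "norm (b * cis \<theta>) \<le> 1" for \<theta> using b by (simp add: norm_mult)
  have cw: "continuous_on {0..pi} w"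
    unfolding w_def using a bz by (intro continuous_intros K continuous_on_qkernel_qderiv_ratio) auto
  have cR: "continuous_on {0..pi} (R n)" for n
    unfolding R_def using a bz by (intro continuous_intros continuous_on_qkernel_qderiv_ratio) auto
  have "bounded (w ` {0..pi})" by (intro compact_imp_bounded compact_continuous_image cw) simp
  then obtain W where W: "W > 0" "\<And>\<theta>. \<theta> \<in> {0..pi} \<Longrightarrow> norm (w \<theta>) \<le> W" by (auto simp: bounded_pos)
  have ab: "norm (a * b) < 1" using a b by (rule norm_mult_less_one)
  obtain B where B: "B \<ge> 0" and qderiv_ratio_le: "\<And>n a' s t u. norm a' < 1 \<Longrightarrow> norm s \<le> 1 \<Longrightarrow> norm t \<le> 1 \<Longrightarrow>
      norm u \<le> 1 \<Longrightarrow> a' * t * u = a * b \<Longrightarrow> norm (qderiv_ratio q n a' s t u) \<le> B * real (Suc n)"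
    using qderiv_ratio_bounded[OF q ab] by blast
  have "a * cis (- \<theta>) * (b * cis \<theta>) = a * b" for \<theta>
    using cis_mult_cis_uminus[of \<theta>] by algebra
  then have R: "norm (R n \<theta>) \<le> B * real (Suc n)" for n \<theta>
    unfolding R_def by (intro qderiv_ratio_le a bz) simp_all
  obtain Q where Q: "Q \<ge> 0" "\<And>n. norm (qpoch f q n / qpoch q q n) \<le> Q" using qratio_bounded[OF q] by blast
  have "((\<lambda>\<theta>. \<Sum>n. e n * (w \<theta> * R n \<theta>)) has_integral (\<Sum>n. e n * m n)) {0..pi}"
  proof (rule has_integral_suminf)
    show "((\<lambda>\<theta>. e n * (w \<theta> * R n \<theta>)) has_integral e n * m n) {0..pi}" for n
      using has_integral_mult_right[OF moments[of n], of "e n"] by (simp add: w_def R_def mult_ac)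
    show "continuous_on {0..pi} (\<lambda>\<theta>. e n * (w \<theta> * R n \<theta>))" for n
      by (intro continuous_intros cw cR)
    show "norm (e n * (w \<theta> * R n \<theta>)) \<le> Q * norm g ^ n * (W * (B * real (Suc n)))" if "\<theta> \<in> {0..pi}" for n \<theta>
      unfolding norm_mult e_def norm_power
      using that B R W Q by (intro mult_mono mult_nonneg_nonneg) auto
    have "summable (\<lambda>n. (Q * W * B) * (of_nat (Suc n) * norm g ^ n))"
      using g by (intro summable_mult sums_summable[OF geometric_deriv_sums]) simp
    then show "summable (\<lambda>n. Q * norm g ^ n * (W * (B * real (Suc n))))"
      by (simp only: mult_ac)
  qed
  moreover have "(\<Sum>n. e n * (w \<theta> * R n \<theta>)) = w \<theta> * phi32_reg q f g a (cis \<theta>) (cis (- \<theta>)) (b * cis \<theta>)" for \<theta>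
  proof -
    have "(\<lambda>n. w \<theta> * (e n * R n \<theta>)) sums (w \<theta> * phi32_reg q f g a (cis \<theta>) (cis (- \<theta>)) (b * cis \<theta>))"
      unfolding e_def R_def by (intro sums_mult phi32_reg_sums q g a bz) auto
    then show ?thesis by (simp add: sums_iff mult_ac)
  qed
  ultimately show ?thesis by (simp add: w_def e_def mult_ac)
qed

lemma has_integral_phi32_reg:
  assumes K: "continuous_on {0..pi} K" and b: "norm b \<le> 1"
    and S: "norm S \<le> 1" and T: "norm T \<le> 1" and U: "norm U \<le> 1"
    and hyp: "\<And>a. norm a < 1 \<Longrightarrow>
      ((\<lambda>\<theta>. K \<theta> * qkernel q a (cis \<theta>) (cis (- \<theta>)) (b * cis \<theta>)) has_integral C * qkernel q a S T U) {0..pi}"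
    and a: "norm a < 1" and g: "norm g < 1"
  shows "((\<lambda>\<theta>. K \<theta> * (qkernel q a (cis \<theta>) (cis (- \<theta>)) (b * cis \<theta>) * phi32_reg q f g a (cis \<theta>) (cis (- \<theta>)) (b * cis \<theta>)))
           has_integral C * (qkernel q a S T U * phi32_reg q f g a S T U)) {0..pi}"
proof -
  have "(\<lambda>n. (C * qkernel q a S T U) * (qpoch f q n / qpoch q q n * g ^ n * qderiv_ratio q n a S T U))
      sums ((C * qkernel q a S T U) * phi32_reg q f g a S T U)"
    by (intro sums_mult phi32_reg_sums q g a S T U)
  then have "(\<Sum>n. qpoch f q n / qpoch q q n * g ^ n * (C * (qkernel q a S T U * qderiv_ratio q n a S T U)))
      = C * (qkernel q a S T U * phi32_reg q f g a S T U)"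
    by (simp add: sums_iff mult_ac)
  with has_integral_phi32_reg_of_moments[OF K b a g has_integral_qderiv_ratio[OF K b S T U hyp a], of f]
  show ?thesis by (simp only:)
qed

text \<open>
  For \<open>f = u = 0\<close> the series is again of \<open>q\<close>-binomial type.
\<close>
lemma phi32_reg_0_0:
  assumes g: "norm g < 1" and a: "norm a < 1" and s: "norm s \<le> 1" and t: "norm t \<le> 1"
  shows "phi32_reg q 0 g a s t 0 = qpoch_inf (a * g * s * t) q / (qpoch_inf (g * s) q * qpoch_inf (g * t) q)"
proof -
  have "norm (g * t) < 1" using g t by (rule norm_mult_less_one)
  from sums_divide[OF qbinomial_theorem[OF q this, of "a * s"], of "qpoch_inf (g * s) q"]
  have "(\<lambda>j. qpoch (a * s) q j / qpoch q q j * (g * t) ^ j / qpoch_inf (g * s) q)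
    sums (qpoch_inf (a * g * s * t) q / (qpoch_inf (g * s) q * qpoch_inf (g * t) q))"
    by (simp add: mult_ac)
  then show ?thesis by (simp add: phi32_reg_def sums_iff)
qed

text \<open>
  The case \<open>f = u = 0\<close> with \<open>g = b\<close>: the kernel is \<open>1/((az)(a/z))\<close> and the series is
  \<open>(ab)/((bz)(b/z))\<close>, so a second parameter of the same kind appears.
\<close>
lemma has_integral_add_parameter:
  assumes K: "continuous_on {0..pi} K" and S: "norm S \<le> 1" and T: "norm T \<le> 1"
    and hyp: "\<And>a. norm a < 1 \<Longrightarrow>
      ((\<lambda>\<theta>. K \<theta> / (qpoch_inf (a * cis \<theta>) q * qpoch_inf (a * cis (- \<theta>)) q))
         has_integral C / (qpoch_inf (a * S) q * qpoch_inf (a * T) q)) {0..pi}"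
    and a: "norm a < 1" and b: "norm b < 1"
  shows "((\<lambda>\<theta>. K \<theta> / (qpoch_inf (a * cis \<theta>) q * qpoch_inf (a * cis (- \<theta>)) q *
                      qpoch_inf (b * cis \<theta>) q * qpoch_inf (b * cis (- \<theta>)) q))
         has_integral C * qpoch_inf (a * b * S * T) q / (qpoch_inf (a * b) q *
           qpoch_inf (a * S) q * qpoch_inf (a * T) q * qpoch_inf (b * S) q * qpoch_inf (b * T) q)) {0..pi}"
proof -
  have ab: "norm (a * b) < 1" using a b by (intro norm_mult_less_one) auto
  have "((\<lambda>\<theta>. K \<theta> * (qkernel q a (cis \<theta>) (cis (- \<theta>)) (0 * cis \<theta>) * phi32_reg q 0 b a (cis \<theta>) (cis (- \<theta>)) (0 * cis \<theta>)))
           has_integral C * (qkernel q a S T 0 * phi32_reg q 0 b a S T 0)) {0..pi}"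
    by (rule has_integral_phi32_reg[OF K _ S T _ _ a b]) (use hyp in \<open>auto simp: qkernel_def\<close>)
  from has_integral_divide[OF this, of "qpoch_inf (a * b) q"] show ?thesis
  proof (rule has_integral_eq_rhs[OF has_integral_eq, rotated])
    fix \<theta>
    have "a * b * cis \<theta> * cis (- \<theta>) = a * b"
      using cis_mult_cis_uminus[of \<theta>] by (simp add: mult.assoc)
    then show "K \<theta> * (qkernel q a (cis \<theta>) (cis (- \<theta>)) (0 * cis \<theta>) * phi32_reg q 0 b a (cis \<theta>) (cis (- \<theta>)) (0 * cis \<theta>)) / qpoch_inf (a * b) q =
       K \<theta> / (qpoch_inf (a * cis \<theta>) q * qpoch_inf (a * cis (- \<theta>)) q *
                      qpoch_inf (b * cis \<theta>) q * qpoch_inf (b * cis (- \<theta>)) q)"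
      using qpoch_inf_nz[OF q ab] by (simp add: phi32_reg_0_0 a b qkernel_def mult.assoc cis_mult_cis_uminus)
  qed (simp add: phi32_reg_0_0 a b S T qkernel_def)
qed

end

section \<open>Orthogonality of the continuous q-Hermite polynomials to constants\<close>

lemma has_integral_cis_period:
  "((\<lambda>\<theta>. cis (of_int k * \<theta>)) has_integral (if k = 0 then 2 * of_real pi else 0)) {-pi..pi}"
proof (cases "k = 0")
  case True
  then show ?thesis using has_integral_const_real[of "1::complex" "-pi" pi] by (simp add: scaleR_conv_of_real)
next
  case False
  define F where "F \<theta> = cis (of_int k * \<theta>) / (\<i> * of_int k)" for \<theta> :: real
  have "(F has_vector_derivative cis (of_int k * x)) (at x within {-pi..pi})" for x
  proof -
    have "((\<lambda>z. exp (\<i> * (of_int k * z)) / (\<i> * of_int k)) has_field_derivative exp (\<i> * (of_int k * of_real x)))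
        (at (of_real x))"
      using False by (auto intro!: derivative_eq_intros simp: field_simps)
    from has_vector_derivative_real_field[OF this] show ?thesis
      by (simp add: F_def[abs_def] cis_conv_exp)
  qed
  then have "((\<lambda>\<theta>. cis (of_int k * \<theta>)) has_integral (F pi - F (- pi))) {-pi..pi}"
    by (intro fundamental_theorem_of_calculus) auto
  moreover have "F pi = F (- pi)"
  proof -
    have "cis (of_int k * pi) = cis (of_int k * - pi)"
      using sin_npi_int[of k] by (simp add: complex_eq_iff mult.commute)
    then show ?thesis by (simp only: F_def)
  qed
  ultimately show ?thesis using False by simp
qed

lemma has_integral_symmetrize:
  fixes f :: "real \<Rightarrow> complex"
  assumes cont: "continuous_on {-c..c} f" and f: "(f has_integral I) {-c..c}" and c: "c \<ge> 0"
  shows "((\<lambda>x. f x + f (- x)) has_integral I) {0..c}"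
proof -
  have int: "f integrable_on {0..c}" "f integrable_on {-c..0}"
    using c by (auto intro!: integrable_continuous_interval continuous_on_subset[OF cont])
  have "((\<lambda>x. f (- x)) has_integral integral {-c..0} f) {0..c}"
    using has_integral_reflect_real[where f = f and i = "integral {-c..0} f" and a = "-c" and b = 0] integrable_integral[OF int(2)] by simp
  from has_integral_add[OF integrable_integral[OF int(1)] this]
  have "((\<lambda>x. f x + f (- x)) has_integral (integral {0..c} f + integral {-c..0} f)) {0..c}" .
  moreover have "integral {-c..0} f + integral {0..c} f = integral {-c..c} f"
    using c f by (intro Henstock_Kurzweil_Integration.integral_combine) auto
  ultimately show ?thesis using f by (simp add: add.commute integral_unique)
qed

lemma qbinom_symmetric: "k \<le> n \<Longrightarrow> qbinom q n (n - k) = qbinom q n k"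
  by (simp add: qbinom_def mult.commute)

lemma qderiv_ratio_zero: "qderiv_ratio q n 0 s t 0 = (\<Sum>j\<le>n. qbinom q n j * (t ^ j * s ^ (n - j)))"
  by (simp add: qderiv_ratio_def)

lemma qderiv_ratio_zero_symmetric: "qderiv_ratio q n 0 s t 0 = qderiv_ratio q n 0 t s 0"
  unfolding qderiv_ratio_zero
  by (rule sum.reindex_bij_witness[where i = "\<lambda>j. n - j" and j = "\<lambda>j. n - j"])
     (auto simp: qbinom_symmetric mult.commute)

lemma qderiv_ratio_zero_cis:
  "qderiv_ratio q n 0 (cis \<theta>) (cis (- \<theta>)) 0 = (\<Sum>j\<le>n. qbinom q n j * cis (of_int (int n - 2 * int j) * \<theta>))"
  unfolding qderiv_ratio_zero
proof (intro sum.cong refl)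
  fix j assume "j \<in> {..n}"
  then have e: "real j * (- \<theta>) + real (n - j) * \<theta> = of_int (int n - 2 * int j) * \<theta>"
    by (simp add: of_nat_diff algebra_simps)
  have "cis (- \<theta>) ^ j * cis \<theta> ^ (n - j) = cis (of_int (int n - 2 * int j) * \<theta>)"
    unfolding Complex.DeMoivre cis_mult e ..
  then show "qbinom q n j * (cis (- \<theta>) ^ j * cis \<theta> ^ (n - j)) =
      qbinom q n j * cis (of_int (int n - 2 * int j) * \<theta>)" by simp
qed

context
  fixes q :: complex
  assumes q: "norm q < 1"
begin

lemma theta_partial_cis:
  "qpoch (cis (2 * \<theta>)) q N * qpoch (q * cis (- 2 * \<theta>)) q N =
     (\<Sum>i\<le>N + N. (qbinom q (N + N) i * theta_coeff q (int i - int N)) * cis (of_int (2 * (int i - int N)) * \<theta>))"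
proof -
  define x where "x = cis (2 * \<theta>)"
  define y where "y = cis (- 2 * \<theta>)"
  have xy: "x * y = 1" using cis_mult_cis_uminus[of "2 * \<theta>"] by (simp add: x_def y_def)
  have "(\<Prod>l<N. x - q ^ Suc l) = (\<Prod>l<N. x * (1 - q * y * q ^ l))"
  proof (intro prod.cong refl)
    fix l
    have "x * (1 - q * y * q ^ l) = x - (x * y) * (q * q ^ l)" by (simp add: algebra_simps)
    then show "x - q ^ Suc l = x * (1 - q * y * q ^ l)" by (simp add: xy)
  qed
  then have P: "(\<Prod>l<N. x - q ^ Suc l) = x ^ N * qpoch (q * y) q N"
    by (simp add: prod.distrib qpoch_def)
  have "qpoch x q N * qpoch (q * y) q N = (x * y) ^ N * (qpoch x q N * qpoch (q * y) q N)"
    by (simp add: xy)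
  also have "\<dots> = y ^ N * (qpoch x q N * (\<Prod>l<N. x - q ^ Suc l))"
    unfolding P by (simp add: power_mult_distrib mult_ac)
  also have "\<dots> = (\<Sum>i\<le>N + N. (qbinom q (N + N) i * theta_coeff q (int i - int N)) * (y ^ N * x ^ i))"
    unfolding finite_triple_product[OF q, symmetric] by (simp add: sum_distrib_left mult_ac)
  also have "\<dots> = (\<Sum>i\<le>N + N. (qbinom q (N + N) i * theta_coeff q (int i - int N)) * cis (of_int (2 * (int i - int N)) * \<theta>))"
  proof (intro sum.cong refl)
    fix i
    have e: "real N * (- 2 * \<theta>) + real i * (2 * \<theta>) = of_int (2 * (int i - int N)) * \<theta>"
      by (simp add: algebra_simps)
    have "y ^ N * x ^ i = cis (of_int (2 * (int i - int N)) * \<theta>)"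
      unfolding x_def y_def Complex.DeMoivre cis_mult e ..
    then show "(qbinom q (N + N) i * theta_coeff q (int i - int N)) * (y ^ N * x ^ i)
       = (qbinom q (N + N) i * theta_coeff q (int i - int N)) * cis (of_int (2 * (int i - int N)) * \<theta>)" by simp
  qed
  finally show ?thesis by (simp add: x_def y_def)
qed

lemma central_qbinom_tendsto:
  "(\<lambda>N. qbinom q (N + N) (nat (int N - r))) \<longlonglongrightarrow> 1 / qpoch_inf q q"
proof -
  have shift: "filterlim (\<lambda>N. nat (int N + r)) at_top sequentially" for r
    unfolding filterlim_at_top eventually_sequentially
  proof (intro allI exI impI)
    fix Z n assume "Z + nat \<bar>r\<bar> \<le> n"
    then show "Z \<le> nat (int n + r)" by linarith
  qed
  have double: "filterlim (\<lambda>N::nat. N + N) at_top sequentially"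
    by (rule filterlim_at_top_mono[OF filterlim_ident]) simp
  have "filterlim (\<lambda>N. nat (int N - r)) at_top sequentially" using shift[of "- r"] by simp
  with shift[of r] double have "(\<lambda>N. qpoch q q (N + N) / (qpoch q q (nat (int N - r)) * qpoch q q (nat (int N + r))))
       \<longlonglongrightarrow> qpoch_inf q q / (qpoch_inf q q * qpoch_inf q q)"
    using qpoch_inf_nz[OF q q]
    by (intro tendsto_divide tendsto_mult filterlim_compose[OF qpoch_tendsto[OF q]]) auto
  moreover have "qpoch_inf q q / (qpoch_inf q q * qpoch_inf q q) = 1 / qpoch_inf q q"
    using qpoch_inf_nz[OF q q] by simp
  moreover have "\<forall>\<^sub>F N in sequentially. qpoch q q (N + N) / (qpoch q q (nat (int N - r)) * qpoch q q (nat (int N + r)))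
      = qbinom q (N + N) (nat (int N - r))"
    unfolding eventually_sequentially
  proof (intro exI[of _ "nat \<bar>r\<bar>"] allI impI)
    fix N assume "nat \<bar>r\<bar> \<le> N"
    then have "nat (int N - r) \<le> N + N" "N + N - nat (int N - r) = nat (int N + r)" by linarith+
    then show "qpoch q q (N + N) / (qpoch q q (nat (int N - r)) * qpoch q q (nat (int N + r)))
      = qbinom q (N + N) (nat (int N - r))" by (simp add: qbinom_def)
  qed
  ultimately show ?thesis using Lim_transform_eventually by force
qed


text \<open>
  The Fourier coefficients of \<open>(z\<^sup>2)(q/z\<^sup>2)\<close>. The truncated products are Laurent polynomials with known
  coefficients and are bounded uniformly, so their integrals converge to the integral sought.
\<close>
lemma has_integral_theta_moment:
  "((\<lambda>\<theta>. qpoch_inf (cis (2 * \<theta>)) q * qpoch_inf (q * cis (- 2 * \<theta>)) q * cis (of_int p * \<theta>)) has_integral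
     (if even p then 2 * of_real pi * theta_coeff q (- (p div 2)) / qpoch_inf q q else 0)) {-pi..pi}"
proof -
  define f where "f N \<theta> = qpoch (cis (2 * \<theta>)) q N * qpoch (q * cis (- 2 * \<theta>)) q N * cis (of_int p * \<theta>)" for N \<theta>
  define L where "L \<theta> = qpoch_inf (cis (2 * \<theta>)) q * qpoch_inf (q * cis (- 2 * \<theta>)) q * cis (of_int p * \<theta>)" for \<theta>
  define c where "c N i = qbinom q (N + N) i * theta_coeff q (int i - int N)" for N i
  define J where "J N = (\<Sum>i\<le>N + N. c N i * (if 2 * (int i - int N) + p = 0 then 2 * of_real pi else 0))" for N
  have fJ: "(f N has_integral J N) {-pi..pi}" for N
  proof -
    have "f N = (\<lambda>\<theta>. \<Sum>i\<le>N + N. c N i * cis (of_int (2 * (int i - int N) + p) * \<theta>))"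
      unfolding f_def theta_partial_cis sum_distrib_right c_def
      by (intro ext sum.cong refl) (simp add: cis_mult distrib_right)
    then show ?thesis unfolding J_def
      by (simp only:) (intro has_integral_sum has_integral_mult_right has_integral_cis_period finite_atMost)
  qed
  define E where "E = exp (1 / (1 - norm q))"
  have "L integrable_on {-pi..pi}" "(\<lambda>N. integral {-pi..pi} (f N)) \<longlonglongrightarrow> integral {-pi..pi} L"
  proof -
    have le: "norm (f N \<theta>) \<le> E * E" for N \<theta>
    proof -
      have "norm (q * cis (- 2 * \<theta>)) \<le> 1" using q by (simp add: norm_mult)
      then show ?thesis unfolding f_def norm_mult[of _ "cis (of_int p * \<theta>)"] norm_mult[of "qpoch _ _ _"] E_def
        using mult_mono[OF norm_qpoch_le[OF q, of "cis (2 * \<theta>)" 1 N] norm_qpoch_le[OF q, of "q * cis (- 2 * \<theta>)" 1 N]]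
        by simp
    qed
    have lim: "(\<lambda>N. f N \<theta>) \<longlonglongrightarrow> L \<theta>" for \<theta>
      unfolding f_def L_def by (intro tendsto_mult qpoch_tendsto q tendsto_const)
    show "L integrable_on {-pi..pi}" "(\<lambda>N. integral {-pi..pi} (f N)) \<longlonglongrightarrow> integral {-pi..pi} L"
      using dominated_convergence[of f "{-pi..pi}" "\<lambda>_. E * E" L] le lim has_integral_integrable[OF fJ]
        integrable_const_ivl[of "E * E" "-pi" pi] by blast+
  qed
  then have LI: "(L has_integral integral {-pi..pi} L) {-pi..pi}" and Jlim: "J \<longlonglongrightarrow> integral {-pi..pi} L"
    using integral_unique[OF fJ] by (auto simp: integrable_integral)
  have "J \<longlonglongrightarrow> (if even p then 2 * of_real pi * theta_coeff q (- (p div 2)) / qpoch_inf q q else 0)"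
  proof (cases "even p")
    case False
    have "2 * (int i - int N) + p \<noteq> 0" for i N using False by presburger
    then show ?thesis using False by (simp add: J_def[abs_def])
  next
    case True
    then obtain r where r: "p = 2 * r" by (elim evenE)
    have "\<forall>\<^sub>F N in sequentially. 2 * of_real pi * theta_coeff q (- r) * qbinom q (N + N) (nat (int N - r)) = J N"
      unfolding eventually_sequentially
    proof (intro exI[of _ "nat \<bar>r\<bar>"] allI impI)
      fix N assume N: "nat \<bar>r\<bar> \<le> N"
      then have i0: "nat (int N - r) \<in> {..N + N}" "int (nat (int N - r)) - int N = - r" by auto
      have "2 * (int i - int N) + p = 0 \<longleftrightarrow> i = nat (int N - r)" for i
      proof -
        have "int (nat (int N - r)) = int N - r" using N by simp
        then have "i = nat (int N - r) \<longleftrightarrow> int i = int N - r" by (metis of_nat_eq_iff)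
        then show ?thesis unfolding r by (auto simp: algebra_simps)
      qed
      then have "J N = (\<Sum>i\<le>N + N. if i = nat (int N - r) then c N i * (2 * of_real pi) else 0)"
        unfolding J_def by (intro sum.cong refl) simp
      also have "\<dots> = c N (nat (int N - r)) * (2 * of_real pi)"
        using i0 by simp
      finally show "2 * of_real pi * theta_coeff q (- r) * qbinom q (N + N) (nat (int N - r)) = J N"
        unfolding c_def i0(2) by simp
    qed
    moreover have "(\<lambda>N. 2 * of_real pi * theta_coeff q (- r) * qbinom q (N + N) (nat (int N - r)))
        \<longlonglongrightarrow> 2 * of_real pi * theta_coeff q (- r) * (1 / qpoch_inf q q)"
      by (intro tendsto_mult tendsto_const central_qbinom_tendsto)
    ultimately have "J \<longlonglongrightarrow> 2 * of_real pi * theta_coeff q (- r) * (1 / qpoch_inf q q)"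
      by (rule Lim_transform_eventually[rotated])
    then show ?thesis using r by simp
  qed
  with Jlim have "integral {-pi..pi} L = (if even p then 2 * of_real pi * theta_coeff q (- (p div 2)) / qpoch_inf q q else 0)"
    by (rule LIMSEQ_unique)
  with LI show ?thesis by (simp add: L_def[abs_def])
qed

text \<open>
  Since \<open>(1 - x)(1 - 1/x) = (1 - x) + (1 - 1/x)\<close>, the symmetric product \<open>(x)(1/x)\<close> is the sum of the theta
  function \<open>(x)(q/x)\<close> and its mirror image.
\<close>
lemma qpoch_inf_theta_split:
  assumes "x * y = 1"
  shows "qpoch_inf x q * qpoch_inf y q = qpoch_inf x q * qpoch_inf (q * y) q + qpoch_inf y q * qpoch_inf (q * x) q"
proof -
  have "(1 - x) * (1 - y) = (1 - x) + (1 - y)" using assms by (simp add: algebra_simps)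
  moreover have "qpoch_inf x q = (1 - x) * qpoch_inf (q * x) q" "qpoch_inf y q = (1 - y) * qpoch_inf (q * y) q"
    using qpoch_inf_step[OF q, of x] qpoch_inf_step[OF q, of y] by (simp_all add: mult.commute)
  ultimately show ?thesis by algebra
qed

text \<open>
  By the splitting of the weight, the integral over half a period is the integral over the whole period of the
  theta function times the even polynomial. For odd \<open>n\<close> every Fourier coefficient involved is zero; for
  \<open>n = 2m\<close> they add up to the triple product \<open>(1;q)\<^sub>m (q;q)\<^sub>m\<close>.
\<close>
lemma has_integral_qhermite:
  "((\<lambda>\<theta>. qpoch_inf (cis (2 * \<theta>)) q * qpoch_inf (cis (- 2 * \<theta>)) q * qderiv_ratio q n 0 (cis \<theta>) (cis (- \<theta>)) 0)
     has_integral (if n = 0 then 2 * of_real pi / qpoch_inf q q else 0)) {0..pi}"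
proof -
  define \<Theta> where "\<Theta> \<theta> = qpoch_inf (cis (2 * \<theta>)) q * qpoch_inf (q * cis (- 2 * \<theta>)) q" for \<theta>
  define H where "H \<theta> = qderiv_ratio q n 0 (cis \<theta>) (cis (- \<theta>)) 0" for \<theta>
  define \<mu> where "\<mu> p = (if even p then 2 * of_real pi * theta_coeff q (- (p div 2)) / qpoch_inf q q else 0)" for p :: int
  have "((\<lambda>\<theta>. \<Sum>j\<le>n. qbinom q n j * (\<Theta> \<theta> * cis (of_int (int n - 2 * int j) * \<theta>))) has_integral
      (\<Sum>j\<le>n. qbinom q n j * \<mu> (int n - 2 * int j))) {-pi..pi}"
    unfolding \<Theta>_def \<mu>_def
    by (intro has_integral_sum has_integral_mult_right has_integral_theta_moment finite_atMost)
  moreover have "(\<lambda>\<theta>. \<Sum>j\<le>n. qbinom q n j * (\<Theta> \<theta> * cis (of_int (int n - 2 * int j) * \<theta>))) = (\<lambda>\<theta>. \<Theta> \<theta> * H \<theta>)"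
    by (simp add: H_def qderiv_ratio_zero_cis sum_distrib_left mult_ac)
  moreover have "(\<Sum>j\<le>n. qbinom q n j * \<mu> (int n - 2 * int j)) = (if n = 0 then 2 * of_real pi / qpoch_inf q q else 0)"
  proof (cases "even n")
    case False
    then have "\<mu> (int n - 2 * int j) = 0" for j by (simp add: \<mu>_def)
    then show ?thesis using False by (auto simp: odd_pos)
  next
    case True
    then obtain m where m: "n = m + m" by (metis evenE mult_2)
    have "\<mu> (int n - 2 * int j) = 2 * of_real pi / qpoch_inf q q * theta_coeff q (int j - int m)" for j
    proof -
      have "int n - 2 * int j = 2 * (int m - int j)" by (simp add: m)
      then show ?thesis by (simp add: \<mu>_def)
    qed
    then have "(\<Sum>j\<le>n. qbinom q n j * \<mu> (int n - 2 * int j)) =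
        2 * of_real pi / qpoch_inf q q * (\<Sum>j\<le>m + m. (qbinom q (m + m) j * theta_coeff q (int j - int m)) * 1 ^ j)"
      by (simp add: m sum_distrib_left mult_ac)
    also have "\<dots> = 2 * of_real pi / qpoch_inf q q * (qpoch 1 q m * (\<Prod>l<m. 1 - q ^ Suc l))"
      by (simp only: finite_triple_product[OF q])
    also have "\<dots> = (if n = 0 then 2 * of_real pi / qpoch_inf q q else 0)"
      by (cases m) (auto simp: m qpoch_Suc_shift)
    finally show ?thesis .
  qed
  ultimately have full: "((\<lambda>\<theta>. \<Theta> \<theta> * H \<theta>) has_integral (if n = 0 then 2 * of_real pi / qpoch_inf q q else 0)) {-pi..pi}"
    by simp
  have cont: "continuous_on {-pi..pi} (\<lambda>\<theta>. \<Theta> \<theta> * H \<theta>)"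
    unfolding \<Theta>_def H_def by (intro continuous_intros continuous_on_qpoch_inf[OF q] continuous_on_qkernel_qderiv_ratio[OF q]) auto
  have "((\<lambda>\<theta>. \<Theta> \<theta> * H \<theta> + \<Theta> (- \<theta>) * H (- \<theta>)) has_integral (if n = 0 then 2 * of_real pi / qpoch_inf q q else 0)) {0..pi}"
    using has_integral_symmetrize[OF cont full] by simp
  moreover have "\<Theta> \<theta> * H \<theta> + \<Theta> (- \<theta>) * H (- \<theta>) =
      qpoch_inf (cis (2 * \<theta>)) q * qpoch_inf (cis (- 2 * \<theta>)) q * H \<theta>" for \<theta>
  proof -
    have "cis (2 * \<theta>) * cis (- 2 * \<theta>) = 1" using cis_mult_cis_uminus[of "2 * \<theta>"] by simp
    from qpoch_inf_theta_split[OF this]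
    have "\<Theta> \<theta> + \<Theta> (- \<theta>) = qpoch_inf (cis (2 * \<theta>)) q * qpoch_inf (cis (- 2 * \<theta>)) q"
      by (simp add: \<Theta>_def)
    moreover have "H (- \<theta>) = H \<theta>" using qderiv_ratio_zero_symmetric by (simp add: H_def)
    ultimately show ?thesis by (simp add: distrib_right[symmetric])
  qed
  ultimately show ?thesis by (simp add: H_def)
qed

end

section \<open>The Askey-Wilson integral and its extension\<close>

context
  fixes q :: complex
  assumes q: "norm q < 1"
begin

text \<open>
  At \<open>a = u = f = 0\<close> the series in \<open>g\<close> is the generating function \<open>1/((gz)(g/z))\<close> of the continuous
  \<open>q\<close>-Hermite polynomials, and only its constant term has a nonzero integral.
\<close>
lemma has_integral_one_parameter:
  assumes a: "norm a < 1"
  shows "((\<lambda>\<theta>. qpoch_inf (cis (2 * \<theta>)) q * qpoch_inf (cis (- 2 * \<theta>)) q /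
             (qpoch_inf (a * cis \<theta>) q * qpoch_inf (a * cis (- \<theta>)) q))
          has_integral 2 * of_real pi / qpoch_inf q q) {0..pi}"
proof -
  define w where "w \<theta> = qpoch_inf (cis (2 * \<theta>)) q * qpoch_inf (cis (- 2 * \<theta>)) q" for \<theta>
  define m where "m n = (if n = 0 then 2 * of_real pi / qpoch_inf q q else 0)" for n :: nat
  have "((\<lambda>\<theta>. w \<theta> * (qkernel q 0 (cis \<theta>) (cis (- \<theta>)) (0 * cis \<theta>) * phi32_reg q 0 a 0 (cis \<theta>) (cis (- \<theta>)) (0 * cis \<theta>)))
      has_integral (\<Sum>n. qpoch 0 q n / qpoch q q n * a ^ n * m n)) {0..pi}"
  proof (rule has_integral_phi32_reg_of_moments[OF q _ _ _ a])
    show "continuous_on {0..pi} w"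
      unfolding w_def by (intro continuous_intros continuous_on_qpoch_inf[OF q])
    show "((\<lambda>\<theta>. w \<theta> * (qkernel q 0 (cis \<theta>) (cis (- \<theta>)) (0 * cis \<theta>) * qderiv_ratio q n 0 (cis \<theta>) (cis (- \<theta>)) (0 * cis \<theta>)))
      has_integral m n) {0..pi}" for n
      using has_integral_qhermite[OF q, of n] by (simp add: qkernel_def w_def m_def)
  qed auto
  moreover have "(\<Sum>n. qpoch 0 q n / qpoch q q n * a ^ n * m n) = 2 * of_real pi / qpoch_inf q q"
    by (subst suminf_finite[of "{0}"]) (auto simp: m_def)
  ultimately show ?thesis by (simp add: qkernel_def phi32_reg_0_0[OF q a] w_def)
qed

lemma continuous_on_inverse_factors:
  assumes "norm c < 1"
  shows "continuous_on A (\<lambda>\<theta>. inverse (qpoch_inf (c * cis \<theta>) q * qpoch_inf (c * cis (- \<theta>)) q))"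
  using assms by (intro continuous_intros continuous_on_qpoch_inf[OF q]) (auto intro!: qpoch_inf_nz[OF q] simp: norm_mult)

text \<open>
  Each step adds \<open>b\<close> to the parameters already present, which are \<open>a\<close> alone, then \<open>a\<close> and \<open>c\<close>, then \<open>a\<close>, \<open>c\<close> and \<open>d\<close>.
  The factors with \<open>c\<close> and \<open>d\<close> are moved into the weight, and the value of the integral, as a function of \<open>a\<close>, is
  \<open>C/((aS)(aT))\<close> with \<open>(S,T)\<close> equal to \<open>(0,0)\<close>, \<open>(c,0)\<close> and \<open>(c,d)\<close> in turn.
\<close>
theorem askey_wilson_integral:
  assumes a: "norm a < 1" and b: "norm b < 1" and c: "norm c < 1" and d: "norm d < 1"
  shows "((\<lambda>\<theta>. qpoch_inf (cis (2 * \<theta>)) q * qpoch_inf (cis (- 2 * \<theta>)) q /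
             (qpoch_inf (a * cis \<theta>) q * qpoch_inf (a * cis (- \<theta>)) q *
              qpoch_inf (b * cis \<theta>) q * qpoch_inf (b * cis (- \<theta>)) q *
              qpoch_inf (c * cis \<theta>) q * qpoch_inf (c * cis (- \<theta>)) q *
              qpoch_inf (d * cis \<theta>) q * qpoch_inf (d * cis (- \<theta>)) q))
          has_integral 2 * of_real pi * qpoch_inf (a * b * c * d) q /
            (qpoch_inf q q * qpoch_inf (a * b) q * qpoch_inf (a * c) q * qpoch_inf (a * d) q *
             qpoch_inf (b * c) q * qpoch_inf (b * d) q * qpoch_inf (c * d) q)) {0..pi}"
proof -
  define w where "w \<theta> = qpoch_inf (cis (2 * \<theta>)) q * qpoch_inf (cis (- 2 * \<theta>)) q" for \<theta>
  define e where "e c \<theta> = inverse (qpoch_inf (c * cis \<theta>) q * qpoch_inf (c * cis (- \<theta>)) q)" for c \<theta>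
  define C where "C = 2 * of_real pi / qpoch_inf q q"
  have w: "continuous_on A w" for A
    unfolding w_def by (intro continuous_intros continuous_on_qpoch_inf[OF q])
  have e: "continuous_on A (e c)" if "norm c < 1" for A c
    unfolding e_def[abs_def] using that by (rule continuous_on_inverse_factors)
  have add: "((\<lambda>\<theta>. K \<theta> * e a \<theta> * e b \<theta>) has_integral
        C * (qpoch_inf (a * b * S * T) q / (qpoch_inf (a * b) q *
           qpoch_inf (a * S) q * qpoch_inf (a * T) q * qpoch_inf (b * S) q * qpoch_inf (b * T) q))) {0..pi}"
    if "continuous_on {0..pi} K" "norm S \<le> 1" "norm T \<le> 1" "norm a < 1" "norm b < 1"
      "\<And>a. norm a < 1 \<Longrightarrow> ((\<lambda>\<theta>. K \<theta> * e a \<theta>) has_integral C / (qpoch_inf (a * S) q * qpoch_inf (a * T) q)) {0..pi}"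
    for K S T C a b
    using has_integral_add_parameter[OF q that(1-3) _ that(4,5), of C] that(6)
    by (simp add: e_def divide_inverse mult.assoc)
  have two: "((\<lambda>\<theta>. w \<theta> * e a \<theta> * e b \<theta>) has_integral C / qpoch_inf (a * b) q) {0..pi}"
    if "norm a < 1" "norm b < 1" for a b
    using add[of w 0 0 a b C] has_integral_one_parameter that w
    by (simp add: w_def e_def C_def divide_inverse)
  have three: "((\<lambda>\<theta>. (w \<theta> * e c \<theta>) * e a \<theta> * e b \<theta>) has_integral
      C / (qpoch_inf (a * b) q * qpoch_inf (a * c) q * qpoch_inf (b * c) q)) {0..pi}"
    if "norm a < 1" "norm b < 1" "norm c < 1" for a b c
    using add[of "\<lambda>\<theta>. w \<theta> * e c \<theta>" c 0 a b C] two[of _ c] that w e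
    by (simp add: continuous_on_mult mult_ac)
  have "((\<lambda>\<theta>. (w \<theta> * e c \<theta> * e d \<theta>) * e a \<theta> * e b \<theta>) has_integral
      C / qpoch_inf (c * d) q * (qpoch_inf (a * b * c * d) q / (qpoch_inf (a * b) q *
           qpoch_inf (a * c) q * qpoch_inf (a * d) q * qpoch_inf (b * c) q * qpoch_inf (b * d) q))) {0..pi}"
    by (rule add) (use three[of _ d c] w e a b c d in \<open>auto intro!: continuous_intros simp: mult_ac\<close>)
  then show ?thesis by (simp add: w_def e_def C_def divide_inverse mult_ac)
qed

end

theorem theorem3p1:
  fixes q a b c d f g :: complex
  assumes "norm q < 1"
    and "Max {norm a, norm b, norm c, norm d, norm g} < 1"
    and "\<And>\<theta> k. \<theta> \<in> {0..pi} \<Longrightarrow> qpoch (f * g * cis \<theta>) q k \<noteq> 0"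
    and "\<And>k. qpoch (c * f * g) q k \<noteq> 0"
  shows "((\<lambda>\<theta>. qpochs_inf [cis (2 * \<theta>), cis (- 2 * \<theta>), f * g * cis \<theta>] q /
             qpochs_inf [a * cis \<theta>, a * cis (- \<theta>), b * cis \<theta>, b * cis (- \<theta>),
                         c * cis \<theta>, c * cis (- \<theta>), d * cis \<theta>, d * cis (- \<theta>), g * cis \<theta>] q *
             phi32 f (a * cis \<theta>) (b * cis \<theta>) (f * g * cis \<theta>) (a * b) q (g * cis (- \<theta>)))
          has_integral
            2 * of_real pi * qpochs_inf [c * f * g, a * b * c * d] q /
              qpochs_inf [q, a * b, a * c, a * d, b * c, b * d, c * d, c * g] q *
            phi32 f (a * c) (b * c) (c * f * g) (a * b * c * d) q (d * g))
         {0..pi}"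
proof -
  note q = assms(1)
  have a: "norm a < 1" and b: "norm b < 1" and c: "norm c < 1" and d: "norm d < 1" and g: "norm g < 1"
    using assms(2) by simp_all
  define K where "K \<theta> = qpoch_inf (cis (2 * \<theta>)) q * qpoch_inf (cis (- 2 * \<theta>)) q *
     inverse (qpoch_inf (b * cis \<theta>) q * qpoch_inf (b * cis (- \<theta>)) q) *
     inverse (qpoch_inf (c * cis \<theta>) q * qpoch_inf (c * cis (- \<theta>)) q) *
     inverse (qpoch_inf (d * cis \<theta>) q * qpoch_inf (d * cis (- \<theta>)) q)" for \<theta>
  define C where "C = 2 * of_real pi / (qpoch_inf q q * qpoch_inf (b * c) q * qpoch_inf (b * d) q * qpoch_inf (c * d) q)"
  have K: "continuous_on {0..pi} K"
    unfolding K_def using b c d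
    by (intro continuous_on_mult continuous_on_inverse_factors[OF q] continuous_on_qpoch_inf[OF q] continuous_intros)
  have bc: "norm (b * c) \<le> 1" using norm_mult_less_one[OF b less_imp_le[OF c]] by simp
  have ab: "a * cis (- \<theta>) * (b * cis \<theta>) = a * b" for a \<theta>
    using cis_mult_cis_uminus[of \<theta>] by algebra
  (* The Askey-Wilson integral times (ab;q), read as an identity between kernels in a. *)
  have aw: "((\<lambda>\<theta>. K \<theta> * qkernel q a (cis \<theta>) (cis (- \<theta>)) (b * cis \<theta>)) has_integral C * qkernel q a c d (b * c)) {0..pi}"
    if a: "norm a < 1" for a
  proof -
    have nz: "qpoch_inf (a * b) q \<noteq> 0"
      using a b by (intro qpoch_inf_nz[OF q] norm_mult_less_one) auto
    have cancel: "A * (B / (Q * A * x1 * x2 * x3 * x4 * x5)) = B / (Q * x1 * x2 * x3 * x4 * x5)"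
      if "A \<noteq> 0" for A B Q x1 x2 x3 x4 x5 :: complex
    proof -
      have "A * (B / (Q * A * x1 * x2 * x3 * x4 * x5)) = (A * B) / (A * (Q * x1 * x2 * x3 * x4 * x5))"
        by (simp add: mult_ac)
      then show ?thesis using that by simp
    qed
    have e: "a * d * (b * c) = a * b * c * d" by (simp add: mult_ac)
    from has_integral_mult_right[OF askey_wilson_integral[OF q a b c d], of "qpoch_inf (a * b) q"]
    show ?thesis
      unfolding cancel[OF nz] qkernel_def ab e K_def C_def by (simp add: divide_inverse mult_ac)
  qed
  have "((\<lambda>\<theta>. K \<theta> * (qkernel q a (cis \<theta>) (cis (- \<theta>)) (b * cis \<theta>) * phi32_reg q f g a (cis \<theta>) (cis (- \<theta>)) (b * cis \<theta>)))
           has_integral C * (qkernel q a c d (b * c) * phi32_reg q f g a c d (b * c))) {0..pi}"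
    using b c d bc by (intro has_integral_phi32_reg q K aw a g) auto
  from has_integral_divide[OF this, of "qpoch_inf (a * b) q"] show ?thesis
  proof (rule has_integral_eq_rhs[OF has_integral_eq, rotated])
    fix \<theta> assume \<theta>: "\<theta> \<in> {0..pi}"
    have bz: "norm (b * cis \<theta>) \<le> 1" using b by (simp add: norm_mult)
    have nz: "qpoch_inf (a * b) q \<noteq> 0" using a b by (intro qpoch_inf_nz[OF q] norm_mult_less_one) auto
    have "phi32_reg q f g a (cis \<theta>) (cis (- \<theta>)) (b * cis \<theta>) = qpoch_inf (f * g * cis \<theta>) q / qpoch_inf (g * cis \<theta>) q *
       phi32 f (a * cis \<theta>) (b * cis \<theta>) (f * g * cis \<theta>) (a * b) q (g * cis (- \<theta>))"
      using phi32_reg_eq_phi32[OF q g a _ _ bz assms(3)[OF \<theta>], of "cis (- \<theta>)"] by (simp add: ab)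
    then show "K \<theta> * (qkernel q a (cis \<theta>) (cis (- \<theta>)) (b * cis \<theta>) * phi32_reg q f g a (cis \<theta>) (cis (- \<theta>)) (b * cis \<theta>)) / qpoch_inf (a * b) q
      = qpochs_inf [cis (2 * \<theta>), cis (- 2 * \<theta>), f * g * cis \<theta>] q /
             qpochs_inf [a * cis \<theta>, a * cis (- \<theta>), b * cis \<theta>, b * cis (- \<theta>),
                         c * cis \<theta>, c * cis (- \<theta>), d * cis \<theta>, d * cis (- \<theta>), g * cis \<theta>] q *
             phi32 f (a * cis \<theta>) (b * cis \<theta>) (f * g * cis \<theta>) (a * b) q (g * cis (- \<theta>))"
      using nz unfolding qkernel_def ab K_def by (simp add: qpochs_inf_def divide_inverse mult_ac)
  next
    have e: "f * g * c = c * f * g" "a * d * (b * c) = a * b * c * d" "g * d = d * g" "g * c = c * g" by (simp_all add: mult_ac)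
    have "phi32_reg q f g a c d (b * c) = qpoch_inf (c * f * g) q / qpoch_inf (c * g) q *
       phi32 f (a * c) (b * c) (c * f * g) (a * b * c * d) q (d * g)"
      using phi32_reg_eq_phi32[OF q g a _ _ bc, of c d f] c d assms(4) unfolding e by simp
    then show "2 * of_real pi * qpochs_inf [c * f * g, a * b * c * d] q /
              qpochs_inf [q, a * b, a * c, a * d, b * c, b * d, c * d, c * g] q *
            phi32 f (a * c) (b * c) (c * f * g) (a * b * c * d) q (d * g)
       = C * (qkernel q a c d (b * c) * phi32_reg q f g a c d (b * c)) / qpoch_inf (a * b) q"
      unfolding qkernel_def e C_def by (simp add: qpochs_inf_def divide_inverse mult_ac)
  qed
qed

end
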